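(* In the setting of the context (GSVD of $(A,B)$, approximate spectral projector $P$, subspace iteration with dimension $p\ge n_{gv}$), suppose $\gamma_p>\gamma_{p+1}$ and $X_p^THX^{(0)}$ is nonsingular. Then for every $k\ge0$, $$\hat X^{(k)}=(X_p+X_{p,\perp}E^{(k)})(M^{(k)})^{-1/2}W^{(k)},$$ where $E^{(k)}=\Gamma_p'^{\,k}X_{p,\perp}^THX^{(0)}(X_p^THX^{(0)})^{-1}\Gamma_p^{-k}$, $M^{(k)}=I+(E^{(k)})^TE^{(k)}$, and $W^{(k)}$ is an orthogonal matrix; moreover $$\|E^{(k)}\|\le\Bigl(\frac{\gamma_{p+1}}{\gamma_p}\Bigr)^k\|E^{(0)}\|,$$ and the distance $\epsilon^{(k)}=\|X_{p,\perp}^TH\hat X^{(k)}\|$ between $\mathcal X^{(k)}$ and $\mathrm{span}\{X_p\}$ satisfies $$\epsilon^{(k)}=\frac{\|E^{(k)}\|}{\sqrt{1+\|E^{(k)}\|^2}}\le\Bigl(\frac{\gamma_{p+1}}{\gamma_p}\Bigr)^k\|E^{(0)}\|.$$ Label the Ritz quintuples $(\hat c_i^{(k)},\hat s_i^{(k)},\hat u_i^{(k)},\hat v_i^{(k)},\hat x_i^{(k)})$, $i=1,\dots,n_{gv}$, so that $\hat c_1^{(k)},\dots,\hat c_{n_{gv}}^{(k)}$ are in the same order as $c_1,\dots,c_{n_{gv}}$, and let $\hat\sigma_i^{(k)}=\hat c_i^{(k)}/\hat s_i^{(k)}$, $\sigma_i=c_i/s_i$. Then $$\chi\bigl((\hat\sigma_i^{(k)})^2,\sigma_i^2\bigr)\le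 6(\epsilon^{(k)})^2+2(\epsilon^{(k)})^4,\qquad i=1,\dots,n_{gv}.$$
   Context: $A\in\mathbb{R}^{m_1\times n}$, $B\in\mathbb{R}^{m_2\times n}$, $m_1+m_2\ge n$, $[A^T,B^T]^T$ of full column rank; $H=A^TA+B^TB$. GSVD: $U^TAX=\Sigma_A$, $V^TBX=\Sigma_B$ with $X=[x_1,\dots,x_n]$ nonsingular, $X^THX=I$, $U,V$ orthogonal, $\Sigma_A^T\Sigma_A=\mathrm{diag}(c_1^2,\dots,c_n^2)$, $\Sigma_B^T\Sigma_B=\mathrm{diag}(s_1^2,\dots,s_n^2)$, $c_i,s_i\ge0$, $c_i^2+s_i^2=1$. $S=H^{-1}(A^TA-B^TB)$. Given $[c_{\min},c_{\max}]\subset[0,1]$ and degree $d$, let $l(z)=2z^2-1$, $\alpha=\arccos(l(c_{\min}))$, $\beta=\arccos(l(c_{\max}))$, $\eta_0=(\alpha-\beta)/\pi$, $\eta_j=2(\sin(j\alpha)-\sin(j\beta))/(j\pi)$, $\rho_{j,d}=\frac{(d+2-j)\sin\frac{\pi}{d+2}\cos\frac{j\pi}{d+2}+\cos\frac{\pi}{d+2}\sin\frac{j\pi}{d+2}}{(d+2)\sin\frac{\pi}{d+2}}$, $\psi_d(x)=\sum_{j=0}^d\rho_{j,d}\eta_jT_j(x)$ ($T_j$ Chebyshev polynomials), $P=\psi_d(S)=X\,\psi_d(2\Sigma_A^T\Sigma_A-I)X^{-1}$, with eigenvalues $\gamma_i=\psi_d(l(c_i))$ and $Px_i=\gamma_ix_i$.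 Indexing: $c_1,\dots,c_r\in(c_{\min},c_{\max})$, $c_{r+1},\dots,c_{n_{gv}}\in\{c_{\min},c_{\max}\}$, $c_{n_{gv}+1},\dots,c_n\notin[c_{\min},c_{\max}]$, with $\gamma_i$ decreasing within each of these three index groups. Let $p\ge n_{gv}$, $X_p=[x_1,\dots,x_p]$, $X_{p,\perp}=[x_{p+1},\dots,x_n]$, $\Gamma_p=\mathrm{diag}(\gamma_1,\dots,\gamma_p)$, $\Gamma_p'=\mathrm{diag}(\gamma_{p+1},\dots,\gamma_n)$. Algorithm (subspace iteration with GSVD projection): start with $X^{(0)}\in\mathbb{R}^{n\times p}$ of full column rank. At iteration $k=0,1,\dots$: take thin QR factorizations $X^{(k)}=Q^{(k)}R^{(k)}$, $AQ^{(k)}=Q_1^{(k)}\bar A^{(k)}$, $BQ^{(k)}=Q_2^{(k)}\bar B^{(k)}$ (assuming $AQ^{(k)},BQ^{(k)}$ have full column rank); compute the GSVD of the $p\times p$ pair $\bar A^{(k)}=\bar U^{(k)}\hat\Sigma_A^{(k)}(\bar X^{(k)})^{-1}$, $\bar B^{(k)}=\bar V^{(k)}\hat\Sigma_B^{(k)}(\bar X^{(k)})^{-1}$ with $\hat\Sigma_A^{(k)}=\mathrm{diag}(\hat c_1^{(k)},\dots,\hat c_p^{(k)})$, $\hat\Sigma_B^{(k)}=\mathrm{diag}(\hat s_1^{(k)},\dots,\hat s_p^{(k)})$, $(\hat c_i^{(k)})^2+(\hat s_i^{(k)})^2=1$; set $\hat X^{(k)}=Q^{(k)}\bar X^{(k)}$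 ($H$-orthonormal), $\hat U^{(k)}=Q_1^{(k)}\bar U^{(k)}$, $\hat V^{(k)}=Q_2^{(k)}\bar V^{(k)}$, Ritz quintuples $(\hat c_i^{(k)},\hat s_i^{(k)},\hat U^{(k)}e_i,\hat V^{(k)}e_i,\hat X^{(k)}e_i)$; then $X^{(k+1)}=P\hat X^{(k)}$. $\mathcal X^{(k)}=\mathrm{span}\{\hat X^{(k)}\}$. Chordal metric: $\chi(\lambda,\mu)=|\lambda-\mu|/(\sqrt{1+|\lambda|^2}\sqrt{1+|\mu|^2})$.
   Formalization: It is additionally assumed that γ_p is the smallest of γ_1,…,γ_p; with γ_i decreasing only within each of the three groups, the bound ‖E^(k)‖ ≤ (γ_{p+1}/γ_p)^k‖E^(0)‖ can fail (e.g. d=1, p=n_gv+1, c_p>c_max, c_{p+1}<c_min). *)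

theory Defs
  imports "HOL-Analysis.Analysis" "Jordan_Normal_Form.Matrix" "Jordan_Normal_Form.Gauss_Jordan_Elimination"
begin

text \<open>Matrices are Jordan_Normal_Form matrices over the reals; all indices are 0-based.\<close>

definition minv :: "real mat \<Rightarrow> real mat" where
  "minv M = (SOME B. inverts_mat M B \<and> inverts_mat B M)"

definition orthonormal_cols :: "real mat \<Rightarrow> bool" where
  "orthonormal_cols Q \<longleftrightarrow> transpose_mat Q * Q = 1\<^sub>m (dim_col Q)"

definition full_col_rank :: "real mat \<Rightarrow> bool" where
  "full_col_rank M \<longleftrightarrow> (\<forall>v \<in> carrier_vec (dim_col M). M *\<^sub>v v = 0\<^sub>v (dim_row M) \<longrightarrow> v = 0\<^sub>v (dim_col M))"

definition sym_pos_def :: "real mat \<Rightarrow> bool" where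
  "sym_pos_def N \<longleftrightarrow> square_mat N \<and> transpose_mat N = N \<and>
     (\<forall>v \<in> carrier_vec (dim_col N). v \<noteq> 0\<^sub>v (dim_col N) \<longrightarrow> v \<bullet> (N *\<^sub>v v) > 0)"

definition vnorm :: "real vec \<Rightarrow> real" where
  "vnorm v = sqrt (v \<bullet> v)"

definition mnorm :: "real mat \<Rightarrow> real" where
  "mnorm M = Sup {vnorm (M *\<^sub>v v) | v. v \<in> carrier_vec (dim_col M) \<and> vnorm v \<le> 1}"

definition diagm :: "nat \<Rightarrow> (nat \<Rightarrow> real) \<Rightarrow> real mat" where
  "diagm n f = mat n n (\<lambda>(i,j). if i = j then f i else 0)"

definition cols_first :: "nat \<Rightarrow> real mat \<Rightarrow> real mat" where
  "cols_first p X = mat (dim_row X) p (\<lambda>(i,j). X $$ (i,j))"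
definition cols_rest :: "nat \<Rightarrow> real mat \<Rightarrow> real mat" where
  "cols_rest p X = mat (dim_row X) (dim_col X - p) (\<lambda>(i,j). X $$ (i,j+p))"

fun cheb :: "nat \<Rightarrow> real \<Rightarrow> real" where
  "cheb 0 x = 1"
| "cheb (Suc 0) x = x"
| "cheb (Suc (Suc j)) x = 2 * x * cheb (Suc j) x - cheb j x"

fun cheb_mat :: "nat \<Rightarrow> real mat \<Rightarrow> real mat" where
  "cheb_mat 0 M = 1\<^sub>m (dim_row M)"
| "cheb_mat (Suc 0) M = M"
| "cheb_mat (Suc (Suc j)) M = 2 \<cdot>\<^sub>m (M * cheb_mat (Suc j) M) - cheb_mat j M"

definition lmap :: "real \<Rightarrow> real" where "lmap z = 2 * z\<^sup>2 - 1"

definition eta :: "real \<Rightarrow> real \<Rightarrow> nat \<Rightarrow> real" where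
  "eta cmin cmax j =
     (let \<alpha> = arccos (lmap cmin); \<beta> = arccos (lmap cmax) in
      if j = 0 then (\<alpha> - \<beta>) / pi
      else 2 * (sin (real j * \<alpha>) - sin (real j * \<beta>)) / (real j * pi))"

definition rho :: "nat \<Rightarrow> nat \<Rightarrow> real" where
  "rho j d =
    ((real (d + 2) - real j) * sin (pi / real (d+2)) * cos (real j * pi / real (d+2))
      + cos (pi / real (d+2)) * sin (real j * pi / real (d+2)))
    / (real (d+2) * sin (pi / real (d+2)))"

definition psi :: "nat \<Rightarrow> real \<Rightarrow> real \<Rightarrow> real \<Rightarrow> real" where
  "psi d cmin cmax x = (\<Sum>j\<le>d. rho j d * eta cmin cmax j * cheb j x)"

definition psi_mat :: "nat \<Rightarrow> real \<Rightarrow> real \<Rightarrow> real mat \<Rightarrow> real mat" where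
  "psi_mat d cmin cmax S =
     foldr (\<lambda>j acc. acc + (rho j d * eta cmin cmax j) \<cdot>\<^sub>m cheb_mat j S) [0..<Suc d]
       (0\<^sub>m (dim_row S) (dim_row S))"

text \<open>Squared generalized singular value (c/s)^2 as an extended real (infinite when s = 0),
  and the chordal metric on the nonnegative extended reals.\<close>
definition sqratio :: "real \<Rightarrow> real \<Rightarrow> ereal" where
  "sqratio c s = (if s = 0 then \<infinity> else ereal ((c / s)\<^sup>2))"

definition chordal :: "real \<Rightarrow> real \<Rightarrow> real" where
  "chordal l m = \<bar>l - m\<bar> / (sqrt (1 + l\<^sup>2) * sqrt (1 + m\<^sup>2))"

definition chordal_e :: "ereal \<Rightarrow> ereal \<Rightarrow> real" where
  "chordal_e x y =
    (if x = \<infinity> \<and> y = \<infinity> then 0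
     else if x = \<infinity> then 1 / sqrt (1 + (real_of_ereal y)\<^sup>2)
     else if y = \<infinity> then 1 / sqrt (1 + (real_of_ereal x)\<^sup>2)
     else chordal (real_of_ereal x) (real_of_ereal y))"

end

theory Submission
  imports Defs "Jordan_Normal_Form.Spectral_Radius"
begin

text \<open>
  The Jackson coefficients are the autocorrelations of a finite sequence, so the Jackson kernel is
  nonnegative and with it the filter values \<open>\<gamma> i\<close>; hence the gap makes the first \<open>p\<close> of them positive and
  bounds the remaining ones in absolute value by \<open>\<gamma> p\<close>. In the coordinates given by the columns of
  \<open>X\<close>, every iterate spans the graph of \<open>E k\<close>, because one step multiplies the two coordinate blocks
  by diagonal matrices. Orthonormality of the Ritz basis then says that its coordinate matrix \<open>T\<close>
  satisfies \<open>T\<^sup>T (I + E\<^sup>T E) T = I\<close>, which gives the polar factorization and the formula for \<open>eps\<close>.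
  For \<open>w = T v\<close> the Rayleigh quotients of \<open>v\<close> (Ritz values) and of \<open>w\<close> (leading \<open>c\<^sup>2\<close>) differ by at most
  \<open>|E w|\<^sup>2 / |v|\<^sup>2 \<le> eps\<^sup>2\<close>, so a dimension count as in the Courant-Fischer theorem bounds
  \<open>|ch\<^sup>2 - c\<^sup>2|\<close> by \<open>eps\<^sup>2\<close>, and the chordal distance is at most twice that.
\<close>

text \<open>The gap only orders the filter values: a negative value of large modulus beyond index
  \<open>p\<close> would escape the ratio bound and could dominate the iteration, so the sign of
  \<open>psi\<close> must be settled before any norm estimate. The sequence behind the Jackson
  coefficients is sin (k pi / (d + 2)) for 0 <= k < d + 2. It is the extremal sequence of Fejer's
  coefficient problem: it makes the first kernel coefficient cos (pi / (d + 2)), the largest that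
  nonnegativity permits in degree \<open>d\<close>. Coordinates along \<open>X\<close> are natural
  because \<open>X\<close> is \<open>H\<close>-orthonormal: its inverse is its transpose times
  \<open>H\<close>, congruence by \<open>X\<close> turns \<open>H\<close> into the identity and the
  Gram matrix of \<open>A\<close> into a diagonal matrix, and \<open>P\<close> acts diagonally. The
  two Rayleigh quotients stay this close because all squared cosines, the trailing ones included,
  lie in [0, 1]. The factor 2 in the chordal estimate is sqrt 2 * sqrt 2, one for each square root
  in the denominator of the metric.\<close>

unbundle no vec_syntax
unbundle no inner_syntax

section \<open>Nonnegativity of the Jackson--Chebyshev filter\<close>

lemma cheb_cos: "cheb j (cos t) = cos (real j * t)"
proof (induction j "cos t" rule: cheb.induct)
  case (3 j)
  have "cos (real (Suc (Suc j)) * t) + cos (real j * t) = 2 * cos t * cos (real (Suc j) * t)"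
    using cos_add[of "real (Suc j) * t" t] cos_diff[of "real (Suc j) * t" t]
    by (simp add: algebra_simps)
  with 3 show ?case by (simp add: algebra_simps)
qed simp_all

text \<open>This is the squared modulus of the sum of \<open>a k\<close> e^(i k t) in real form;
  expanding the product collects the autocorrelation of \<open>a\<close> at lag \<open>j\<close> in
  front of cos (j t). It is the source of nonnegativity.\<close>

lemma power2_norm_trig_sum:
  fixes a :: "nat \<Rightarrow> real"
  shows "(\<Sum>k<m. a k * cos (real k * t))\<^sup>2 + (\<Sum>k<m. a k * sin (real k * t))\<^sup>2
    = (\<Sum>k<m. (a k)\<^sup>2) + 2 * (\<Sum>j=1..<m. (\<Sum>k<m - j. a k * a (k + j)) * cos (real j * t))"
proof (induction m)
  case (Suc m)
  have expand: "(C + b * x)\<^sup>2 + (S + b * y)\<^sup>2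
    = (C\<^sup>2 + S\<^sup>2) + 2 * b * (C * x + S * y) + b\<^sup>2 * (y\<^sup>2 + x\<^sup>2)" for C S b x y :: real
    by (simp add: power2_eq_square algebra_simps)
  let ?C = "\<Sum>k<m. a k * cos (real k * t)" and ?S = "\<Sum>k<m. a k * sin (real k * t)"
  have "?C * cos (real m * t) + ?S * sin (real m * t)
    = (\<Sum>k<m. a k * cos (real k * t) * cos (real m * t) + a k * sin (real k * t) * sin (real m * t))"
    by (simp only: sum_distrib_right sum.distrib)
  also have "\<dots> = (\<Sum>k<m. a k * cos (real (m - k) * t))"
  proof (rule sum.cong)
    fix k assume "k \<in> {..<m}"
    then have "cos (real (m - k) * t) = cos (real k * t) * cos (real m * t) + sin (real k * t) * sin (real m * t)"
      by (simp add: of_nat_diff left_diff_distrib cos_diff)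
    then show "a k * cos (real k * t) * cos (real m * t) + a k * sin (real k * t) * sin (real m * t)
      = a k * cos (real (m - k) * t)" by (simp only: distrib_left mult.assoc)
  qed simp
  also have "\<dots> = (\<Sum>j=1..<Suc m. a (m - j) * cos (real j * t))"
    by (rule sum.reindex_bij_witness[of _ "\<lambda>j. m - j" "\<lambda>j. m - j"]) auto
  finally have cross: "?C * cos (real m * t) + ?S * sin (real m * t)
    = (\<Sum>j=1..<Suc m. a (m - j) * cos (real j * t))" .
  \<comment> \<open>Passing from \<open>m\<close> to \<open>Suc m\<close> adds to each lag
    \<open>j\<close> exactly one product, \<open>a (m - j) * a m\<close>; the lag \<open>m\<close>
    itself is new.\<close>
  have "(\<Sum>j=1..<Suc m. (\<Sum>k<Suc m - j. a k * a (k + j)) * cos (real j * t))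
    = (\<Sum>j=1..<Suc m. (\<Sum>k<m - j. a k * a (k + j)) * cos (real j * t)
        + a m * (a (m - j) * cos (real j * t)))"
    by (rule sum.cong) (auto simp: Suc_diff_le algebra_simps)
  also have "\<dots> = (\<Sum>j=1..<m. (\<Sum>k<m - j. a k * a (k + j)) * cos (real j * t))
     + a m * (?C * cos (real m * t) + ?S * sin (real m * t))"
    unfolding cross by (simp add: sum.distrib sum_distrib_left del: sum.op_ivl_Suc)
      (cases "m = 0"; simp)
  finally have R: "(\<Sum>j=1..<Suc m. (\<Sum>k<Suc m - j. a k * a (k + j)) * cos (real j * t))
    = (\<Sum>j=1..<m. (\<Sum>k<m - j. a k * a (k + j)) * cos (real j * t))
     + a m * (?C * cos (real m * t) + ?S * sin (real m * t))" .
  have "(?C + a m * cos (real m * t))\<^sup>2 + (?S + a m * sin (real m * t))\<^sup>2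
    = (?C\<^sup>2 + ?S\<^sup>2) + 2 * a m * (?C * cos (real m * t) + ?S * sin (real m * t))
      + (a m)\<^sup>2 * ((sin (real m * t))\<^sup>2 + (cos (real m * t))\<^sup>2)"
    by (rule expand)
  then show ?case
    unfolding R Suc.IH by (simp add: algebra_simps)
qed simp

text \<open>Multiplication by sin x makes the cosines along an arithmetic progression telescope.
  Leaving that factor on the left avoids a case distinction at the zeros of the sine.\<close>

lemma sin_mult_sum_cos:
  fixes x y :: real
  shows "sin x * (\<Sum>k<n. cos (2 * real k * x + y)) = sin (real n * x) * cos ((real n - 1) * x + y)"
proof (induction n)
  case (Suc n)
  have *: "2 * sin a * cos b = sin (a + b) + sin (a - b)" for a b :: real
    by (simp add: sin_add sin_diff)
  have "2 * (sin x * (\<Sum>k<Suc n. cos (2 * real k * x + y)))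
    = 2 * sin (real n * x) * cos ((real n - 1) * x + y) + 2 * sin x * cos (2 * real n * x + y)"
    using Suc by (simp add: algebra_simps)
  also have "\<dots> = 2 * sin (real (Suc n) * x) * cos ((real (Suc n) - 1) * x + y)"
    unfolding * using sin_minus[of "x - (2 * real n * x + y)"] by (simp add: algebra_simps)
  finally show ?case by simp
qed simp

text \<open>Product-to-sum splits every summand into a constant and a cosine along an arithmetic
  progression. The constants give the term of \<open>rho\<close> with the factor d + 2 - j, which is
  the number of summands; the progression gives the other term.\<close>

lemma rho_autocorrelation:
  assumes "j \<le> Suc d"
  shows "(\<Sum>k<d + 2 - j. sin (real k * pi / real (d + 2)) * sin (real (k + j) * pi / real (d + 2)))
    = real (d + 2) / 2 * rho j d"
proof -
  define m where "m = d + 2"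
  define x where "x = pi / real m"
  have "0 < m" "m > 1" by (simp_all add: m_def)
  have "sin x > 0" unfolding x_def using \<open>m > 1\<close> by (intro sin_gt_zero) (auto simp: field_simps)
  have mx: "real m * x = pi" using \<open>0 < m\<close> by (simp add: x_def)
  have jm: "j < m" using assms by (simp add: m_def)
  have prod: "sin (real k * x) * sin (real (k + j) * x)
      = (cos (real j * x) - cos (2 * real k * x + real j * x)) / 2" for k
    using cos_add[of "real k * x" "real (k + j) * x"] cos_diff[of "real (k + j) * x" "real k * x"]
    by (simp add: algebra_simps)
  \<comment> \<open>Since m x = pi, the closed form of the progression reduces to functions of x and
    j x alone.\<close>
  have "(real m - real j) * x = pi - real j * x" using mx by (simp add: algebra_simps)
  then have s1: "sin (real (m - j) * x) = sin (real j * x)" using jm by (simp add: of_nat_diff)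
  have "(real (m - j) - 1) * x + real j * x = pi - x"
    using mx jm by (simp add: of_nat_diff algebra_simps)
  then have s2: "cos ((real (m - j) - 1) * x + real j * x) = - cos x" by simp
  have "(\<Sum>k<m - j. cos (2 * real k * x + real j * x)) = - sin (real j * x) * cos x / sin x"
    using sin_mult_sum_cos[of x "real j * x" "m - j"] \<open>sin x > 0\<close>
    unfolding s1 s2 by (simp add: field_simps)
  then have "(\<Sum>k<m - j. sin (real k * x) * sin (real (k + j) * x))
    = (real (m - j) * cos (real j * x) + sin (real j * x) * cos x / sin x) / 2"
    unfolding prod by (simp add: sum_subtractf flip: sum_divide_distrib)
  also have "\<dots> = real m / 2 * (((real m - real j) * sin x * cos (real j * x)
      + cos x * sin (real j * x)) / (real m * sin x))"
    using \<open>sin x > 0\<close> \<open>0 < m\<close> jm by (simp add: field_simps of_nat_diff)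
  finally show ?thesis
    unfolding rho_def m_def[symmetric] x_def by simp
qed

lemma rho_0 [simp]: "rho 0 d = 1"
proof -
  have "sin (pi / real (d + 2)) > 0" by (intro sin_gt_zero) (auto simp: field_simps intro!: add_pos_nonneg)
  then show ?thesis by (simp add: rho_def)
qed

text \<open>Up to the factor m / 2 the kernel is the squared modulus belonging to the sine
  sequence.\<close>

lemma jackson_kernel_nonneg: "0 \<le> 1 + 2 * (\<Sum>j=1..d. rho j d * cos (real j * t))"
proof -
  define m where "m = d + 2"
  define a where "a k = sin (real k * pi / real m)" for k
  have rho: "(\<Sum>k<m - j. a k * a (k + j)) = real m / 2 * rho j d" if "j \<le> Suc d" for j
    using rho_autocorrelation[OF that] by (simp add: m_def a_def)
  \<comment> \<open>At lag d + 1 only k = 0 remains, and \<open>a 0\<close> = sin 0 = 0. Hence d + 2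
    coefficients still give a kernel of degree \<open>d\<close>.\<close>
  have last: "(\<Sum>k<m - Suc d. a k * a (k + Suc d)) = 0"
    by (simp add: m_def a_def)
  have "(\<Sum>k<m. (a k)\<^sup>2) = real m / 2"
    using rho[of 0] by (simp add: power2_eq_square)
  moreover have "(\<Sum>j=1..<m. (\<Sum>k<m - j. a k * a (k + j)) * cos (real j * t))
    = (\<Sum>j=1..d. real m / 2 * rho j d * cos (real j * t))"
  proof -
    have "{1..<m} = insert (Suc d) {1..d}" by (auto simp: m_def)
    then show ?thesis using last by (simp add: rho)
  qed
  ultimately have "0 \<le> real m / 2 + 2 * (\<Sum>j=1..d. real m / 2 * rho j d * cos (real j * t))"
    using power2_norm_trig_sum[where a = a and m = m and t = t]
      sum_power2_ge_zero[of "\<Sum>k<m. a k * cos (real k * t)" "\<Sum>k<m. a k * sin (real k * t)"]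
    by simp
  also have "\<dots> = real m / 2 * (1 + 2 * (\<Sum>j=1..d. rho j d * cos (real j * t)))"
    by (simp add: algebra_simps sum_distrib_left)
  finally show ?thesis by (simp add: m_def zero_le_mult_iff)
qed

text \<open>In the variable x = cos t, the polynomial psi is the convolution of the indicator function
  of the interval with the Jackson kernel; G is the antiderivative of the integrand.\<close>
lemma psi_nonneg:
  assumes "0 \<le> cmin" "cmin \<le> cmax" "cmax \<le> 1" and x: "\<bar>x\<bar> \<le> 1"
  shows "0 \<le> psi d cmin cmax x"
proof -
  define t where "t = arccos x"
  have t: "cos t = x" using x by (simp add: t_def cos_arccos_abs)
  define F where "F u j = rho j d * (2 * sin (real j * u) / real j) * cos (real j * t)" for u j
  define G where "G u = (u + (\<Sum>j=1..d. F u j)) / pi" for u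
  have l: "-1 \<le> lmap cmin" "lmap cmin \<le> lmap cmax" "lmap cmax \<le> 1"
    using assms by (auto simp: lmap_def power_mono abs_square_le_1)
  then have le: "arccos (lmap cmax) \<le> arccos (lmap cmin)"
    by (intro arccos_le_arccos) auto
  have "\<exists>y. (G has_real_derivative y) (at u) \<and> 0 \<le> y" for u
  proof (intro exI conjI)
    let ?y = "(1 + (\<Sum>j=1..d. rho j d * (2 * cos (real j * u)) * cos (real j * t))) / pi"
    show "(G has_real_derivative ?y) (at u)"
      unfolding G_def F_def by (auto intro!: derivative_eq_intros sum.cong)
    \<comment> \<open>Product-to-sum shows that the derivative of \<open>G\<close> is, up to 1 / pi,
      the mean of the kernel at t - u and at t + u.\<close>
    have "rho j d * (2 * cos (real j * u)) * cos (real j * t)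
      = rho j d * cos (real j * (t - u)) + rho j d * cos (real j * (t + u))" for j
      by (simp add: algebra_simps cos_add cos_diff)
    then have "1 + (\<Sum>j=1..d. rho j d * (2 * cos (real j * u)) * cos (real j * t))
      = ((1 + 2 * (\<Sum>j=1..d. rho j d * cos (real j * (t - u))))
        + (1 + 2 * (\<Sum>j=1..d. rho j d * cos (real j * (t + u))))) / 2"
      by (simp add: sum.distrib)
    then show "0 \<le> ?y"
      using jackson_kernel_nonneg[of d "t - u"] jackson_kernel_nonneg[of d "t + u"] by simp
  qed
  then have "G (arccos (lmap cmax)) \<le> G (arccos (lmap cmin))"
    using DERIV_nonneg_imp_nondecreasing[OF le, of G] by blast
  moreover have "psi d cmin cmax x = G (arccos (lmap cmin)) - G (arccos (lmap cmax))"
  proof -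
    \<comment> \<open>The term j = 0 has \<open>rho 0 d = 1\<close> and is the increment of the
      linear part u / pi of \<open>G\<close>.\<close>
    have "{..d} = insert 0 {1..d}" by auto
    then have "psi d cmin cmax x = eta cmin cmax 0 + (\<Sum>j=1..d. rho j d * eta cmin cmax j * cos (real j * t))"
      unfolding psi_def t[symmetric] by (simp add: cheb_cos)
    also have "(\<Sum>j=1..d. rho j d * eta cmin cmax j * cos (real j * t))
      = (\<Sum>j=1..d. (F (arccos (lmap cmin)) j - F (arccos (lmap cmax)) j) / pi)"
      by (rule sum.cong) (auto simp: eta_def F_def Let_def field_simps)
    also have "\<dots> = ((\<Sum>j=1..d. F (arccos (lmap cmin)) j) - (\<Sum>j=1..d. F (arccos (lmap cmax)) j)) / pi"
      by (simp add: sum_subtractf flip: sum_divide_distrib)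
    finally show ?thesis
      by (simp add: G_def eta_def Let_def field_simps)
  qed
  ultimately show ?thesis by simp
qed

section \<open>Spectral theorem and inverse square roots\<close>

text \<open>With carrier premises the shared dimensions are variables that matching cannot
  determine; equations between \<open>dim_row\<close> and \<open>dim_col\<close> turn this law, and
  the ones below, into conditional rewrite rules.\<close>

lemma assoc_mult_mat_dim:
  "dim_col A = dim_row B \<Longrightarrow> dim_col B = dim_row C \<Longrightarrow> A * B * C = A * (B * C)"
  for A B C :: "'a :: semiring_0 mat"
  by (rule assoc_mult_mat[of A "dim_row A" "dim_row B" B "dim_row C" C "dim_col C"]) auto

lemma mult_add_distrib_mat_dim:
  "dim_col A = dim_row B \<Longrightarrow> dim_row B = dim_row C \<Longrightarrow> dim_col B = dim_col C \<Longrightarrow> A * (B + C) = A * B + A * C"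
  for A B C :: "real mat"
  by (rule mult_add_distrib_mat[of A "dim_row A" "dim_row B" B "dim_col B" C]) auto

lemma add_mult_distrib_mat_dim:
  "dim_col A = dim_row C \<Longrightarrow> dim_row A = dim_row B \<Longrightarrow> dim_col A = dim_col B \<Longrightarrow> (A + B) * C = A * C + B * C"
  for A B C :: "real mat"
  by (rule add_mult_distrib_mat[of A "dim_row A" "dim_col A" B C "dim_col C"]) auto

lemma one_mult_mat_dim: "dim_row M = n \<Longrightarrow> 1\<^sub>m n * M = M" and mult_one_mat_dim: "dim_col M = n \<Longrightarrow> M * 1\<^sub>m n = M"
  for M :: "real mat"
  by (auto intro!: eq_matI)

lemma transpose_mult_dim:
  "dim_col A = dim_row B \<Longrightarrow> transpose_mat (A * B) = transpose_mat B * transpose_mat A"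
  for A B :: "'a :: comm_semiring_0 mat"
  by (rule transpose_mult[of A "dim_row A" "dim_row B" B "dim_col B"]) auto

lemma assoc_mult_mat_vec_dim:
  "dim_col A = dim_row B \<Longrightarrow> dim_col B = dim_vec v \<Longrightarrow> A * B *\<^sub>v v = A *\<^sub>v (B *\<^sub>v v)"
  for A B :: "'a :: semiring_0 mat"
  by (rule assoc_mult_mat_vec[of A "dim_row A" "dim_row B" B "dim_vec v" v]) (auto intro: carrier_vecI)

lemma scalar_prod_mult_mat_vec:
  fixes M :: "real mat"
  assumes "dim_row M = dim_vec u" "dim_col M = dim_vec v"
  shows "u \<bullet> (M *\<^sub>v v) = (transpose_mat M *\<^sub>v u) \<bullet> v"
proof -
  have "u \<bullet> (M *\<^sub>v v) = (\<Sum>i = 0..<dim_vec u. \<Sum>j = 0..<dim_vec v. M $$ (i, j) * u $ i * v $ j)"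
    using assms by (simp add: scalar_prod_def sum_distrib_left mult_ac)
  also have "\<dots> = (\<Sum>j = 0..<dim_vec v. \<Sum>i = 0..<dim_vec u. M $$ (i, j) * u $ i * v $ j)"
    by (rule sum.swap)
  also have "\<dots> = (transpose_mat M *\<^sub>v u) \<bullet> v"
    using assms by (simp add: scalar_prod_def sum_distrib_right)
  finally show ?thesis .
qed

lemma scalar_prod_self: "v \<bullet> v = (\<Sum>i<dim_vec v. (v $ i)\<^sup>2)" for v :: "real vec"
  by (simp add: scalar_prod_def power2_eq_square atLeast0LessThan)

lemma scalar_prod_self_ge_0: "0 \<le> v \<bullet> v" for v :: "real vec"
  by (simp add: scalar_prod_self sum_nonneg)

lemma scalar_prod_self_eq_0: "v \<bullet> v = 0 \<longleftrightarrow> v = 0\<^sub>v (dim_vec v)" for v :: "real vec"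
  by (auto simp: scalar_prod_self sum_nonneg_eq_0_iff vec_eq_iff)

lemma scalar_prod_self_pos:
  fixes v :: "real vec"
  shows "v \<in> carrier_vec n \<Longrightarrow> v \<noteq> 0\<^sub>v n \<Longrightarrow> 0 < v \<bullet> v"
  using scalar_prod_self_ge_0[of v] scalar_prod_self_eq_0[of v] by (auto simp: less_le)

lemma mult_mat_zero_vec [simp]: "dim_col M = n \<Longrightarrow> M *\<^sub>v 0\<^sub>v n = 0\<^sub>v (dim_row M)" for M :: "real mat"
  by (auto intro!: eq_vecI simp: scalar_prod_def)

lemma diagm_dim [simp]: "dim_row (diagm n f) = n" "dim_col (diagm n f) = n"
  by (simp_all add: diagm_def)

lemma diagm_carrier [simp]: "diagm n f \<in> carrier_mat n n"
  by (simp add: diagm_def)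

lemma diagm_index [simp]: "i < n \<Longrightarrow> j < n \<Longrightarrow> diagm n f $$ (i, j) = (if i = j then f i else 0)"
  by (simp add: diagm_def)

lemma transpose_diagm [simp]: "transpose_mat (diagm n f) = diagm n f"
  by (rule eq_matI) auto

lemma mult_diagm_index:
  "dim_col M = n \<Longrightarrow> i < dim_row M \<Longrightarrow> j < n \<Longrightarrow> (M * diagm n f) $$ (i, j) = M $$ (i, j) * f j"
  by (simp add: scalar_prod_def if_distrib[of "(*) _"] sum.delta cong: if_cong)

lemma diagm_mult_index:
  "dim_row M = n \<Longrightarrow> i < n \<Longrightarrow> j < dim_col M \<Longrightarrow> (diagm n f * M) $$ (i, j) = f i * M $$ (i, j)"
  by (simp add: scalar_prod_def if_distrib[of "\<lambda>x. x * _"] sum.delta cong: if_cong)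

lemma diagm_mult_diagm: "diagm n f * diagm n g = diagm n (\<lambda>i. f i * g i)"
  by (rule eq_matI) (auto simp: mult_diagm_index simp del: index_mult_mat(1))

lemma diagm_one: "(\<And>i. i < n \<Longrightarrow> f i = 1) \<Longrightarrow> diagm n f = 1\<^sub>m n"
  by (rule eq_matI) auto

lemma diagm_mult_vec_index:
  "dim_vec v = n \<Longrightarrow> i < n \<Longrightarrow> (diagm n f *\<^sub>v v) $ i = f i * v $ i"
  by (simp add: scalar_prod_def if_distrib[of "\<lambda>x. x * _"] sum.delta cong: if_cong)

lemma scalar_prod_diagm:
  "dim_vec v = n \<Longrightarrow> v \<bullet> (diagm n f *\<^sub>v v) = (\<Sum>i<n. f i * (v $ i)\<^sup>2)"
  by (simp add: scalar_prod_def[of v] diagm_mult_vec_index power2_eq_square atLeast0LessThan mult_ac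
      del: index_mult_mat_vec)

text \<open>Over the complex numbers the spectrum is nonempty. Splitting an eigenvector as a + i b
  and comparing a . M b with M a . b gives Im z * (|a|^2 + |b|^2) = 0, so the eigenvalue is real and
  whichever of a, b is nonzero is a real eigenvector.\<close>

lemma symmetric_real_eigenvector:
  fixes M :: "real mat"
  assumes M: "M \<in> carrier_mat n n" and sym: "transpose_mat M = M" and n: "0 < n"
  obtains v l where "v \<in> carrier_vec n" "v \<bullet> v = 1" "M *\<^sub>v v = l \<cdot>\<^sub>v v"
proof -
  define C where "C = map_mat complex_of_real M"
  have C: "C \<in> carrier_mat n n" using M by (simp add: C_def)
  obtain z w where w: "w \<in> carrier_vec n" "w \<noteq> 0\<^sub>v n" "C *\<^sub>v w = z \<cdot>\<^sub>v w"
    using spectrum_non_empty[OF C n] C by (auto simp: spectrum_def eigenvalue_def eigenvector_def)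
  define a where "a = vec n (\<lambda>i. Re (w $ i))"
  define b where "b = vec n (\<lambda>i. Im (w $ i))"
  have a: "a \<in> carrier_vec n" "dim_vec a = n" and b: "b \<in> carrier_vec n" "dim_vec b = n"
    by (simp_all add: a_def b_def)
  have row: "(\<Sum>j = 0..<n. complex_of_real (M $$ (i, j)) * w $ j) = z * w $ i" if "i < n" for i
  proof -
    have "(\<Sum>j = 0..<n. complex_of_real (M $$ (i, j)) * w $ j) = (C *\<^sub>v w) $ i"
      using that w(1) M by (simp add: C_def scalar_prod_def)
    then show ?thesis using that w(1) by (simp add: w(3))
  qed
  have Ma: "M *\<^sub>v a = Re z \<cdot>\<^sub>v a - Im z \<cdot>\<^sub>v b"
  proof (rule eq_vecI)
    fix i assume "i < dim_vec (Re z \<cdot>\<^sub>v a - Im z \<cdot>\<^sub>v b)"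
    then have i: "i < n" by (simp add: b)
    show "(M *\<^sub>v a) $ i = (Re z \<cdot>\<^sub>v a - Im z \<cdot>\<^sub>v b) $ i"
      using arg_cong[OF row[OF i], of Re] i M by (simp add: scalar_prod_def a_def b_def)
  qed (use M in \<open>simp add: b\<close>)
  have Mb: "M *\<^sub>v b = Re z \<cdot>\<^sub>v b + Im z \<cdot>\<^sub>v a"
  proof (rule eq_vecI)
    fix i assume "i < dim_vec (Re z \<cdot>\<^sub>v b + Im z \<cdot>\<^sub>v a)"
    then have i: "i < n" by (simp add: a)
    show "(M *\<^sub>v b) $ i = (Re z \<cdot>\<^sub>v b + Im z \<cdot>\<^sub>v a) $ i"
      using arg_cong[OF row[OF i], of Im] i M by (simp add: scalar_prod_def a_def b_def)
  qed (use M in \<open>simp add: a\<close>)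
  have ne: "a \<noteq> 0\<^sub>v n \<or> b \<noteq> 0\<^sub>v n"
  proof (rule ccontr)
    assume "\<not> ?thesis"
    then have "\<forall>i<n. a $ i = 0 \<and> b $ i = 0" by auto
    then have "w = 0\<^sub>v n" using w by (intro eq_vecI) (auto simp: a_def b_def complex_eq_iff)
    with w show False by simp
  qed
  have "a \<bullet> (M *\<^sub>v b) = (M *\<^sub>v a) \<bullet> b"
    using scalar_prod_mult_mat_vec[of M a b] M a b sym by simp
  then have "Re z * (a \<bullet> b) + Im z * (a \<bullet> a) = Re z * (a \<bullet> b) - Im z * (b \<bullet> b)"
    unfolding Ma Mb using a b
    by (simp add: scalar_prod_add_distrib[of _ n] minus_scalar_prod_distrib[of _ n])
  then have "Im z * (a \<bullet> a + b \<bullet> b) = 0" by (simp add: algebra_simps)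
  moreover have "a \<bullet> a + b \<bullet> b > 0"
    using ne scalar_prod_self_pos[OF a(1)] scalar_prod_self_pos[OF b(1)]
      scalar_prod_self_ge_0[of a] scalar_prod_self_ge_0[of b] by linarith
  ultimately have z: "Im z = 0" by simp
  obtain u where u: "u \<in> carrier_vec n" "u \<noteq> 0\<^sub>v n" "M *\<^sub>v u = Re z \<cdot>\<^sub>v u"
  proof -
    have "M *\<^sub>v a = Re z \<cdot>\<^sub>v a" unfolding Ma z using a b by (intro eq_vecI) auto
    moreover have "M *\<^sub>v b = Re z \<cdot>\<^sub>v b" unfolding Mb z using a b by (intro eq_vecI) auto
    ultimately show thesis using ne that a b by blast
  qed
  have pos: "u \<bullet> u > 0" by (rule scalar_prod_self_pos[OF u(1,2)])
  define q where "q = 1 / sqrt (u \<bullet> u)"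
  show thesis
  proof (rule that[of "q \<cdot>\<^sub>v u" "Re z"])
    show "q \<cdot>\<^sub>v u \<in> carrier_vec n" using u by simp
    show "(q \<cdot>\<^sub>v u) \<bullet> (q \<cdot>\<^sub>v u) = 1"
      using u pos by (simp add: q_def)
    show "M *\<^sub>v (q \<cdot>\<^sub>v u) = Re z \<cdot>\<^sub>v (q \<cdot>\<^sub>v u)"
      using u M by (simp add: mult_mat_vec[of _ n n] smult_smult_assoc mult.commute)
  qed
qed

text \<open>For v equal to the unit vector, w = 0 and division by zero makes the reflection the identity.\<close>
lemma householder_reflection:
  fixes v :: "real vec"
  assumes v: "v \<in> carrier_vec n" and unit: "v \<bullet> v = 1" and n: "0 < n"
  obtains Q where "Q \<in> carrier_mat n n" "transpose_mat Q = Q" "Q * Q = 1\<^sub>m n" "Q *\<^sub>v v = unit_vec n 0"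
proof -
  \<comment> \<open>\<open>w\<close> is v - e_0, the normal of the mirror that exchanges the two
    unit vectors v and e_0; \<open>t\<close> is 2 / |w|^2.\<close>
  define w where "w i = v $ i - (if i = 0 then 1 else 0)" for i
  define W where "W = (\<Sum>i = 0..<n. w i * w i)"
  define t where "t = 2 / W"
  define Q where "Q = mat n n (\<lambda>(i, j). (if i = j then 1 else 0) - t * w i * w j)"
  have tW: "t * t * W = 2 * t" by (simp add: t_def field_simps)
  have vv: "(\<Sum>i = 0..<n. v $ i * v $ i) = 1"
    using unit v by (simp add: scalar_prod_def)
  have wv: "(\<Sum>i = 0..<n. w i * v $ i) = 1 - v $ 0"
    unfolding w_def using vv n
    by (simp add: left_diff_distrib sum_subtractf if_distrib[of "\<lambda>x. x * _"] sum.delta cong: if_cong)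
  have "W = (\<Sum>i = 0..<n. w i * v $ i) - (\<Sum>i = 0..<n. w i * (if i = 0 then 1 else 0))"
    unfolding W_def by (simp add: w_def right_diff_distrib flip: sum_subtractf)
  also have "(\<Sum>i = 0..<n. w i * (if i = 0 then 1 else 0)) = v $ 0 - 1"
    using n by (simp add: w_def if_distrib[of "(*) _"] sum.delta cong: if_cong)
  finally have W: "W = 2 * (1 - v $ 0)" by (simp add: wv)
  have w0: "w i = 0" if "W = 0" "i < n" for i
    using that unfolding W_def by (subst (asm) sum_nonneg_eq_0_iff) auto
  show thesis
  proof (rule that)
    show "Q \<in> carrier_mat n n" by (simp add: Q_def)
    show "transpose_mat Q = Q" by (rule eq_matI) (auto simp: Q_def)
    show "Q * Q = 1\<^sub>m n"
    proof (rule eq_matI)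
      fix i j assume "i < dim_row (1\<^sub>m n)" "j < dim_col (1\<^sub>m n)"
      then have ij: "i < n" "j < n" by auto
      have "(Q * Q) $$ (i, j) = (\<Sum>k = 0..<n. ((if i = k then 1 else 0) - t * w i * w k)
          * ((if k = j then 1 else 0) - t * w k * w j))"
        using ij by (simp add: Q_def scalar_prod_def)
      also have "\<dots> = (\<Sum>k = 0..<n. (if i = k then if k = j then 1 else 0 else 0)
          - (if i = k then t * w k * w j else 0) - (if k = j then t * w i * w k else 0)
          + t * t * w i * w j * (w k * w k))"
        by (intro sum.cong) (auto simp: algebra_simps)
      also have "\<dots> = (if i = j then 1 else 0) - 2 * t * w i * w j + t * t * w i * w j * W"
        using ij by (simp add: sum.distrib sum_subtractf sum.delta sum.delta' W_def flip: sum_distrib_left)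
      also have "t * t * w i * w j * W = (t * t * W) * w i * w j" by (simp add: mult_ac)
      finally show "(Q * Q) $$ (i, j) = 1\<^sub>m n $$ (i, j)" unfolding tW using ij by simp
    qed (simp_all add: Q_def)
    show "Q *\<^sub>v v = unit_vec n 0"
    proof (rule eq_vecI)
      fix i assume "i < dim_vec (unit_vec n 0 :: real vec)"
      then have i: "i < n" by simp
      have "(Q *\<^sub>v v) $ i = (\<Sum>k = 0..<n. ((if i = k then 1 else 0) - t * w i * w k) * v $ k)"
        using i v by (simp add: Q_def scalar_prod_def)
      also have "\<dots> = (\<Sum>k = 0..<n. (if i = k then v $ k else 0) - t * w i * (w k * v $ k))"
        by (intro sum.cong) (auto simp: algebra_simps)
      also have "\<dots> = v $ i - t * w i * (1 - v $ 0)"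
        using i by (simp add: sum_subtractf wv flip: sum_distrib_left)
      also have "\<dots> = v $ i - w i"
      proof (cases "W = 0")
        case False
        then have "t * (1 - v $ 0) = 1" using W by (simp add: t_def)
        then have "t * w i * (1 - v $ 0) = w i" by (metis mult.assoc mult.commute mult_1)
        then show ?thesis by simp
      qed (simp add: w0 i)
      finally show "(Q *\<^sub>v v) $ i = unit_vec n 0 $ i" using i by (simp add: w_def)
    qed (simp add: Q_def)
  qed
qed

text \<open>Direct sum of a scalar and a matrix: it carries a diagonalization of the deflated block
  back to the full dimension. Writing it with \<open>four_block_mat\<close> reduces its product rule
  to block multiplication.\<close>

definition dsum1 :: "real \<Rightarrow> real mat \<Rightarrow> real mat" where
  "dsum1 a M = four_block_mat (diagm 1 (\<lambda>_. a)) (0\<^sub>m 1 (dim_col M)) (0\<^sub>m (dim_row M) 1) M"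

lemma dsum1_dim [simp]: "dim_row (dsum1 a M) = Suc (dim_row M)" "dim_col (dsum1 a M) = Suc (dim_col M)"
  by (simp_all add: dsum1_def)

lemma dsum1_index:
  "i < Suc (dim_row M) \<Longrightarrow> j < Suc (dim_col M) \<Longrightarrow> dsum1 a M $$ (i, j)
    = (if i = 0 \<and> j = 0 then a else if i = 0 \<or> j = 0 then 0 else M $$ (i - 1, j - 1))"
  by (auto simp: dsum1_def)

lemma dsum1_mult: "dim_col M = dim_row N \<Longrightarrow> dsum1 a M * dsum1 b N = dsum1 (a * b) (M * N)"
  unfolding dsum1_def
  by (subst mult_four_block_mat[of _ 1 1 _ "dim_col M" _ "dim_row M" _ _ 1 _ "dim_col N"])
    (auto simp: diagm_mult_diagm intro!: cong_four_block_mat eq_matI)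

lemma dsum1_transpose: "transpose_mat (dsum1 a M) = dsum1 a (transpose_mat M)"
  by (rule eq_matI) (auto simp: dsum1_index)

lemma dsum1_diagm: "dsum1 a (diagm n f) = diagm (Suc n) (case_nat a f)"
  by (rule eq_matI) (auto simp: dsum1_index split: nat.split)

text \<open>Deflation: a reflection moves a unit eigenvector to e_0, which clears the first column
  below the diagonal; symmetry clears the first row, and the induction hypothesis applies to the
  remaining block.\<close>

lemma symmetric_diagonalization:
  assumes "M \<in> carrier_mat n n" "transpose_mat M = M"
  shows "\<exists>Q f. Q \<in> carrier_mat n n \<and> transpose_mat Q * Q = 1\<^sub>m n \<and> M = Q * diagm n f * transpose_mat Q"
  using assms
proof (induction n arbitrary: M)
  case 0
  then show ?case by (intro exI[of _ "1\<^sub>m 0"] exI[of _ "\<lambda>_. 0"]) (auto intro!: eq_matI)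
next
  case (Suc n)
  note M = Suc.prems(1) and sym = Suc.prems(2)
  obtain v l where v: "v \<in> carrier_vec (Suc n)" "v \<bullet> v = 1" "M *\<^sub>v v = l \<cdot>\<^sub>v v"
    using symmetric_real_eigenvector[OF M sym] by auto
  obtain Q0 where Q0: "Q0 \<in> carrier_mat (Suc n) (Suc n)" "transpose_mat Q0 = Q0"
    "Q0 * Q0 = 1\<^sub>m (Suc n)" "Q0 *\<^sub>v v = unit_vec (Suc n) 0"
    using householder_reflection[OF v(1,2)] by auto
  note dims = M[THEN carrier_matD(1)] M[THEN carrier_matD(2)] Q0(1)[THEN carrier_matD(1)]
    Q0(1)[THEN carrier_matD(2)] carrier_vecD[OF v(1)]
  define M1 where "M1 = Q0 * M * Q0"
  have M1: "dim_row M1 = Suc n" "dim_col M1 = Suc n" by (simp_all add: M1_def dims)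
  have M1sym: "transpose_mat M1 = M1"
    by (simp add: M1_def transpose_mult_dim assoc_mult_mat_dim dims Q0 sym)
  have "Q0 *\<^sub>v unit_vec (Suc n) 0 = Q0 * Q0 *\<^sub>v v"
    by (subst assoc_mult_mat_vec_dim) (simp_all add: dims Q0(4))
  then have "Q0 *\<^sub>v unit_vec (Suc n) 0 = v"
    using v by (simp add: Q0(3))
  then have "M1 *\<^sub>v unit_vec (Suc n) 0 = l \<cdot>\<^sub>v unit_vec (Suc n) 0"
    using v Q0 by (simp add: M1_def assoc_mult_mat_vec_dim dims mult_mat_vec[OF Q0(1) v(1)])
  moreover have "(M1 *\<^sub>v unit_vec (Suc n) 0) $ i = M1 $$ (i, 0)" if "i < Suc n" for i
    using that M1 by simp
  ultimately have col0: "M1 $$ (i, 0) = (if i = 0 then l else 0)" if "i < Suc n" for i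
    using that by (metis index_smult_vec(1) index_unit_vec(1,3) mult.right_neutral mult_zero_right zero_less_Suc)
  then have row0: "M1 $$ (0, j) = (if j = 0 then l else 0)" if "j < Suc n" for j
    using that M1 M1sym by (metis index_transpose_mat(1) zero_less_Suc)
  define M' where "M' = mat n n (\<lambda>(i, j). M1 $$ (Suc i, Suc j))"
  have M': "M' \<in> carrier_mat n n" by (simp add: M'_def)
  have "transpose_mat M' = M'"
    using M1 M1sym by (intro eq_matI) (auto simp: M'_def, metis Suc_less_eq index_transpose_mat(1))
  then obtain Q' f where Q': "Q' \<in> carrier_mat n n" "transpose_mat Q' * Q' = 1\<^sub>m n"
    "M' = Q' * diagm n f * transpose_mat Q'"
    using Suc.IH[OF M'] by blast
  have dimQ': "dim_row Q' = n" "dim_col Q' = n" using Q' by auto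
  have "M1 = dsum1 l M'"
    by (rule eq_matI) (auto simp: dsum1_index M1 M'_def col0 row0)
  also have "\<dots> = dsum1 1 Q' * diagm (Suc n) (case_nat l f) * transpose_mat (dsum1 1 Q')"
    unfolding Q'(3) by (simp add: dsum1_mult dsum1_transpose dimQ' flip: dsum1_diagm)
  finally have M1eq: "M1 = dsum1 1 Q' * diagm (Suc n) (case_nat l f) * transpose_mat (dsum1 1 Q')" .
  have orth: "transpose_mat (dsum1 1 Q') * dsum1 1 Q' = 1\<^sub>m (Suc n)"
    by (auto simp: dsum1_mult dsum1_transpose dimQ' Q'(2) dsum1_index intro!: eq_matI)
  have Q0l: "Q0 * (Q0 * Y) = Y" if "dim_row Y = Suc n" for Y
    using that by (simp add: dims Q0(3) flip: assoc_mult_mat_dim)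
  have "M = (Q0 * Q0) * M * (Q0 * Q0)" using M by (simp add: Q0(3))
  also have "\<dots> = Q0 * M1 * Q0" by (simp add: M1_def assoc_mult_mat_dim dims)
  finally have "M = Q0 * M1 * Q0" .
  then have "M = (Q0 * dsum1 1 Q') * diagm (Suc n) (case_nat l f) * transpose_mat (Q0 * dsum1 1 Q')"
    unfolding M1eq by (simp add: transpose_mult_dim assoc_mult_mat_dim dims dimQ' Q0(2))
  moreover have "transpose_mat (Q0 * dsum1 1 Q') * (Q0 * dsum1 1 Q') = 1\<^sub>m (Suc n)"
    using orth by (simp add: transpose_mult_dim assoc_mult_mat_dim dims dimQ' Q0(2) Q0l)
  moreover have "Q0 * dsum1 1 Q' \<in> carrier_mat (Suc n) (Suc n)"
    by (rule carrier_matI) (simp_all add: dims dimQ')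
  ultimately show ?case by blast
qed

text \<open>The root is taken on the eigenvalues, which are positive because the quadratic form of
  \<open>M\<close> at the i-th column of \<open>Q\<close> equals \<open>f i\<close>.\<close>

lemma sym_pos_def_inverse_sqrt:
  assumes M: "M \<in> carrier_mat n n" and spd: "sym_pos_def M"
  obtains N where "N \<in> carrier_mat n n" "sym_pos_def N" "N * N * M = 1\<^sub>m n"
proof -
  have sym: "transpose_mat M = M" using spd by (simp add: sym_pos_def_def)
  obtain Q f where Q: "Q \<in> carrier_mat n n" "transpose_mat Q * Q = 1\<^sub>m n"
    and Meq: "M = Q * diagm n f * transpose_mat Q"
    using symmetric_diagonalization[OF M sym] by blast
  have dimQ: "dim_row Q = n" "dim_col Q = n" using Q by auto
  have QQ: "Q * transpose_mat Q = 1\<^sub>m n"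
    using mat_mult_left_right_inverse[of "transpose_mat Q" n Q] Q by simp
  have Ql: "transpose_mat Q * (Q * Y) = Y" if "dim_row Y = n" for Y
    using that by (simp add: dimQ Q(2) flip: assoc_mult_mat_dim)
  have inj: "transpose_mat Q *\<^sub>v v \<noteq> 0\<^sub>v n" if "v \<in> carrier_vec n" "v \<noteq> 0\<^sub>v n" for v
  proof
    assume "transpose_mat Q *\<^sub>v v = 0\<^sub>v n"
    then have "Q *\<^sub>v (transpose_mat Q *\<^sub>v v) = 0\<^sub>v n" using dimQ by simp
    moreover have "Q *\<^sub>v (transpose_mat Q *\<^sub>v v) = v"
      using that by (simp add: dimQ QQ flip: assoc_mult_mat_vec_dim)
    ultimately show False using that by simp
  qed
  have quad: "v \<bullet> (Q * diagm n g * transpose_mat Q *\<^sub>v v)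
      = (\<Sum>i<n. g i * ((transpose_mat Q *\<^sub>v v) $ i)\<^sup>2)" if "v \<in> carrier_vec n" for v g
  proof -
    have "v \<bullet> (Q * diagm n g * transpose_mat Q *\<^sub>v v)
      = (transpose_mat Q *\<^sub>v v) \<bullet> (diagm n g *\<^sub>v (transpose_mat Q *\<^sub>v v))"
      using that by (simp add: assoc_mult_mat_vec_dim dimQ scalar_prod_mult_mat_vec)
    then show ?thesis by (simp add: scalar_prod_diagm dimQ del: index_mult_mat_vec)
  qed
  have pos: "f i > 0" if i: "i < n" for i
  proof -
    have QTQ: "transpose_mat Q *\<^sub>v (Q *\<^sub>v unit_vec n i) = unit_vec n i"
      by (simp add: dimQ Q(2) flip: assoc_mult_mat_vec_dim)
    have "Q *\<^sub>v unit_vec n i \<noteq> 0\<^sub>v n"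
    proof
      assume "Q *\<^sub>v unit_vec n i = 0\<^sub>v n"
      with QTQ have "unit_vec n i = (0\<^sub>v n :: real vec)" by (simp add: dimQ)
      then show False using i by (metis index_unit_vec(2) index_zero_vec(1) zero_neq_one)
    qed
    moreover have "Q *\<^sub>v unit_vec n i \<in> carrier_vec n" using Q by simp
    ultimately have "(Q *\<^sub>v unit_vec n i) \<bullet> (M *\<^sub>v (Q *\<^sub>v unit_vec n i)) > 0"
      using spd M by (auto simp: sym_pos_def_def)
    then have "0 < (\<Sum>j<n. f j * (unit_vec n i $ j)\<^sup>2)"
      unfolding Meq using quad[of "Q *\<^sub>v unit_vec n i" f] Q QTQ by simp
    also have "\<dots> = (\<Sum>j<n. if j = i then f j else 0)"
      by (rule sum.cong) (auto simp: unit_vec_def)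
    finally show ?thesis using i by simp
  qed
  define g where "g i = 1 / sqrt (f i)" for i
  define N where "N = Q * diagm n g * transpose_mat Q"
  have gpos: "g i > 0" if "i < n" for i using pos[OF that] by (simp add: g_def)
  show thesis
  proof (rule that)
    show N: "N \<in> carrier_mat n n" using Q by (auto simp: N_def)
    have "v \<bullet> (N *\<^sub>v v) > 0" if v: "v \<in> carrier_vec n" "v \<noteq> 0\<^sub>v n" for v
    proof -
      obtain i where i: "i < n" "(transpose_mat Q *\<^sub>v v) $ i \<noteq> 0"
        using inj[OF v] dimQ by (auto simp: vec_eq_iff simp del: index_mult_mat_vec)
      have "(\<Sum>i<n. g i * ((transpose_mat Q *\<^sub>v v) $ i)\<^sup>2) > 0"
        using i gpos by (intro sum_pos2[of _ i]) (auto simp: less_imp_le)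
      then show ?thesis unfolding N_def quad[OF v(1)] .
    qed
    moreover have "transpose_mat N = N"
      by (simp add: N_def transpose_mult_dim assoc_mult_mat_dim dimQ)
    ultimately show "sym_pos_def N" using N by (auto simp: sym_pos_def_def)
    have "N * N * M = Q * (diagm n g * (diagm n g * diagm n f)) * transpose_mat Q"
      unfolding N_def Meq by (simp add: assoc_mult_mat_dim dimQ Ql)
    also have "diagm n g * (diagm n g * diagm n f) = 1\<^sub>m n"
      unfolding diagm_mult_diagm by (rule diagm_one) (use pos in \<open>force simp: g_def\<close>)
    finally show "N * N * M = 1\<^sub>m n" using Q QQ by simp
  qed
qed

section \<open>Operator norms and graph subspaces\<close>

lemma vnorm_ge_0 [simp]: "0 \<le> vnorm v"
  by (simp add: vnorm_def scalar_prod_self_ge_0)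

lemma vnorm_power2: "(vnorm v)\<^sup>2 = v \<bullet> v"
  by (simp add: vnorm_def scalar_prod_self_ge_0)

lemma vnorm_le_iff: "0 \<le> b \<Longrightarrow> vnorm u \<le> b * vnorm v \<longleftrightarrow> u \<bullet> u \<le> b\<^sup>2 * (v \<bullet> v)"
  using abs_le_square_iff[of "vnorm u" "b * vnorm v"] by (simp add: power_mult_distrib vnorm_power2)

lemma vnorm_zero [simp]: "vnorm (0\<^sub>v n) = 0"
  by (simp add: vnorm_def scalar_prod_def)

lemma vnorm_smult: "vnorm (a \<cdot>\<^sub>v v) = \<bar>a\<bar> * vnorm v"
proof -
  have "(a \<cdot>\<^sub>v v) \<bullet> (a \<cdot>\<^sub>v v) = a\<^sup>2 * (v \<bullet> v)"
    by (simp add: scalar_prod_self sum_distrib_left power_mult_distrib)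
  then show ?thesis by (simp add: vnorm_def real_sqrt_mult)
qed

text \<open>The constant is the Frobenius norm, by Cauchy-Schwarz on each row. Some finite bound is
  needed before the supremum in \<open>mnorm\<close> can be used as an upper bound.\<close>

lemma mult_mat_vec_bounded:
  fixes M :: "real mat"
  obtains C where "0 \<le> C" "\<And>v. v \<in> carrier_vec (dim_col M) \<Longrightarrow> vnorm (M *\<^sub>v v) \<le> C * vnorm v"
proof
  define K where "K = (\<Sum>i<dim_row M. row M i \<bullet> row M i)"
  have K: "0 \<le> K" unfolding K_def by (intro sum_nonneg scalar_prod_self_ge_0)
  then show "0 \<le> sqrt K" by simp
  fix v :: "real vec" assume v: "v \<in> carrier_vec (dim_col M)"
  have "(row M i \<bullet> v)\<^sup>2 \<le> (row M i \<bullet> row M i) * (v \<bullet> v)" for i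
    using Cauchy_Schwarz_ineq_sum[of "\<lambda>j. row M i $ j" "\<lambda>j. v $ j" "{0..<dim_col M}"] v
    by (simp add: scalar_prod_def power2_eq_square)
  then have "(M *\<^sub>v v) \<bullet> (M *\<^sub>v v) \<le> K * (v \<bullet> v)"
    by (simp add: scalar_prod_self[of "M *\<^sub>v v"] K_def sum_distrib_right sum_mono)
  then show "vnorm (M *\<^sub>v v) \<le> sqrt K * vnorm v"
    using K by (subst vnorm_le_iff) simp_all
qed

lemma mnorm_set_bdd_above:
  "bdd_above {vnorm (M *\<^sub>v v) | v. v \<in> carrier_vec (dim_col M) \<and> vnorm v \<le> 1}"
proof -
  obtain C where C: "0 \<le> C" "\<And>v. v \<in> carrier_vec (dim_col M) \<Longrightarrow> vnorm (M *\<^sub>v v) \<le> C * vnorm v"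
    using mult_mat_vec_bounded[of M] by blast
  show ?thesis
  proof (rule bdd_aboveI[of _ C], safe)
    fix v :: "real vec" assume "v \<in> carrier_vec (dim_col M)" "vnorm v \<le> 1"
    then show "vnorm (M *\<^sub>v v) \<le> C" using C(2)[of v] mult_left_mono[of "vnorm v" 1 C] C(1) by simp
  qed
qed

lemma mnorm_ge_0 [simp]: "0 \<le> mnorm M"
proof -
  have "vnorm (M *\<^sub>v 0\<^sub>v (dim_col M)) \<le> mnorm M"
    unfolding mnorm_def
    by (rule cSup_upper[OF _ mnorm_set_bdd_above]) (auto intro!: exI[of _ "0\<^sub>v (dim_col M)"])
  then show ?thesis by simp
qed

lemma vnorm_mult_mat_vec_le:
  assumes v: "v \<in> carrier_vec (dim_col M)"
  shows "vnorm (M *\<^sub>v v) \<le> mnorm M * vnorm v"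
proof (cases "v = 0\<^sub>v (dim_col M)")
  case False
  then have pos: "0 < vnorm v"
    using scalar_prod_self_pos[OF v] by (simp add: vnorm_def)
  let ?u = "(1 / vnorm v) \<cdot>\<^sub>v v"
  have "vnorm (M *\<^sub>v ?u) \<le> mnorm M"
    unfolding mnorm_def using v pos
    by (intro cSup_upper[OF _ mnorm_set_bdd_above]) (auto simp: vnorm_smult intro!: exI[of _ ?u])
  moreover have "M *\<^sub>v ?u = (1 / vnorm v) \<cdot>\<^sub>v (M *\<^sub>v v)"
    using v by (intro mult_mat_vec[of _ "dim_row M" "dim_col M"]) auto
  ultimately show ?thesis using pos by (simp add: vnorm_smult field_simps)
qed simp

lemma mnorm_le:
  assumes "0 \<le> b" "\<And>v. v \<in> carrier_vec (dim_col M) \<Longrightarrow> vnorm (M *\<^sub>v v) \<le> b * vnorm v"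
  shows "mnorm M \<le> b"
  unfolding mnorm_def
proof (rule cSup_least, goal_cases)
  case 1
  \<comment> \<open>The zero vector keeps the set nonempty even when \<open>M\<close> has no
    columns.\<close>
  show ?case by (auto intro!: exI[of _ "0\<^sub>v (dim_col M)"])
next
  case (2 x)
  then obtain v where v: "x = vnorm (M *\<^sub>v v)" "v \<in> carrier_vec (dim_col M)" "vnorm v \<le> 1" by blast
  then show ?case using assms(2)[of v] mult_left_mono[of "vnorm v" 1 b] assms(1) by simp
qed

lemma mnorm_mult_le:
  assumes "dim_col A = dim_row B"
  shows "mnorm (A * B) \<le> mnorm A * mnorm B"
proof (rule mnorm_le)
  fix v :: "real vec" assume v: "v \<in> carrier_vec (dim_col (A * B))"
  have "vnorm (A * B *\<^sub>v v) = vnorm (A *\<^sub>v (B *\<^sub>v v))"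
    using v assms by (simp add: assoc_mult_mat_vec_dim)
  also have "\<dots> \<le> mnorm A * vnorm (B *\<^sub>v v)"
    using assms by (intro vnorm_mult_mat_vec_le) (auto intro: carrier_vecI)
  also have "\<dots> \<le> mnorm A * (mnorm B * vnorm v)"
    using v by (intro mult_left_mono vnorm_mult_mat_vec_le) simp_all
  finally show "vnorm (A * B *\<^sub>v v) \<le> mnorm A * mnorm B * vnorm v" by (simp add: mult.assoc)
qed simp

lemma mnorm_diagm_le:
  assumes "0 \<le> b" "\<And>i. i < n \<Longrightarrow> \<bar>f i\<bar> \<le> b"
  shows "mnorm (diagm n f) \<le> b"
proof (rule mnorm_le[OF \<open>0 \<le> b\<close>])
  fix v :: "real vec" assume "v \<in> carrier_vec (dim_col (diagm n f))"
  then have v: "dim_vec v = n" by simp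
  have "(diagm n f *\<^sub>v v) \<bullet> (diagm n f *\<^sub>v v) = (\<Sum>i<n. (f i)\<^sup>2 * (v $ i)\<^sup>2)"
    using v by (simp add: scalar_prod_self diagm_mult_vec_index power_mult_distrib del: index_mult_mat_vec)
  also have "\<dots> \<le> b\<^sup>2 * (v \<bullet> v)"
    using assms v abs_le_square_iff[of "f _" b]
    unfolding scalar_prod_self sum_distrib_left v by (intro sum_mono mult_right_mono) auto
  finally show "vnorm (diagm n f *\<^sub>v v) \<le> b * vnorm v"
    using \<open>0 \<le> b\<close> by (simp add: vnorm_le_iff)
qed

text \<open>Points of the graph of \<open>E\<close> are pairs (w, E w), here with w = T v. The
  right-hand side is the block diagonal form with blocks \<open>D\<close> and \<open>F\<close> at
  such a point, so the left-hand matrix is the compression of that form to the graph.\<close>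

lemma quadratic_form_graph:
  fixes T D E F :: "real mat"
  assumes "D \<in> carrier_mat p p" "E \<in> carrier_mat q p" "F \<in> carrier_mat q q" "T \<in> carrier_mat p p"
    and v: "v \<in> carrier_vec p"
  shows "v \<bullet> (transpose_mat T * (D + transpose_mat E * F * E) * T *\<^sub>v v)
    = (T *\<^sub>v v) \<bullet> (D *\<^sub>v (T *\<^sub>v v)) + (E *\<^sub>v (T *\<^sub>v v)) \<bullet> (F *\<^sub>v (E *\<^sub>v (T *\<^sub>v v)))"
proof -
  note dims = assms(1-4)[THEN carrier_matD(1)] assms(1-4)[THEN carrier_matD(2)] carrier_vecD[OF v]
  define w where "w = T *\<^sub>v v"
  have w: "w \<in> carrier_vec p" "dim_vec w = p" using assms unfolding w_def by auto
  have "v \<bullet> (transpose_mat T * (D + transpose_mat E * F * E) * T *\<^sub>v v)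
    = v \<bullet> (transpose_mat T *\<^sub>v ((D + transpose_mat E * F * E) *\<^sub>v w))"
    by (simp add: assoc_mult_mat_vec_dim dims w_def)
  also have "\<dots> = w \<bullet> ((D + transpose_mat E * F * E) *\<^sub>v w)"
    by (subst scalar_prod_mult_mat_vec) (simp_all add: dims w_def)
  also have "(D + transpose_mat E * F * E) *\<^sub>v w = D *\<^sub>v w + transpose_mat E * F * E *\<^sub>v w"
    by (rule add_mult_distrib_mat_vec[of _ p p]) (simp_all add: w assms(1,2) carrier_matI dims)
  also have "transpose_mat E * F * E *\<^sub>v w = transpose_mat E *\<^sub>v (F *\<^sub>v (E *\<^sub>v w))"
    by (simp add: assoc_mult_mat_vec_dim dims w)
  also have "w \<bullet> (D *\<^sub>v w + transpose_mat E *\<^sub>v (F *\<^sub>v (E *\<^sub>v w)))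
      = w \<bullet> (D *\<^sub>v w) + w \<bullet> (transpose_mat E *\<^sub>v (F *\<^sub>v (E *\<^sub>v w)))"
    by (rule scalar_prod_add_distrib[of _ p]) (auto intro!: carrier_vecI simp: w dims)
  also have "w \<bullet> (transpose_mat E *\<^sub>v (F *\<^sub>v (E *\<^sub>v w))) = (E *\<^sub>v w) \<bullet> (F *\<^sub>v (E *\<^sub>v w))"
    by (subst scalar_prod_mult_mat_vec) (simp_all add: dims w)
  finally show ?thesis by (simp only: w_def)
qed

text \<open>The case of identity blocks: \<open>orth\<close> says that v is mapped isometrically to
  the pair (T v, E T v).\<close>

lemma graph_norm_split:
  fixes E T :: "real mat"
  assumes E: "E \<in> carrier_mat q p" and T: "T \<in> carrier_mat p p"
    and orth: "transpose_mat T * (1\<^sub>m p + transpose_mat E * E) * T = 1\<^sub>m p"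
    and v: "v \<in> carrier_vec p"
  shows "v \<bullet> v = (T *\<^sub>v v) \<bullet> (T *\<^sub>v v) + (E *\<^sub>v (T *\<^sub>v v)) \<bullet> (E *\<^sub>v (T *\<^sub>v v))"
proof -
  have "v \<bullet> (transpose_mat T * (1\<^sub>m p + transpose_mat E * 1\<^sub>m q * E) * T *\<^sub>v v)
    = (T *\<^sub>v v) \<bullet> (1\<^sub>m p *\<^sub>v (T *\<^sub>v v)) + (E *\<^sub>v (T *\<^sub>v v)) \<bullet> (1\<^sub>m q *\<^sub>v (E *\<^sub>v (T *\<^sub>v v)))"
    using E T v by (intro quadratic_form_graph[of _ p _ q]) auto
  then show ?thesis
    using E T v by (simp add: orth right_mult_one_mat[of "transpose_mat E" p q]
        one_mult_mat_vec[of "T *\<^sub>v v" p] one_mult_mat_vec[of "E *\<^sub>v (T *\<^sub>v v)" q] mult_mat_vec_carrier)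
qed

lemma graph_gram_sym_pos_def:
  assumes E: "E \<in> carrier_mat q p"
  shows "sym_pos_def (1\<^sub>m p + transpose_mat E * E)"
proof -
  note dims = carrier_matD[OF E]
  have "transpose_mat (1\<^sub>m p + transpose_mat E * E) = 1\<^sub>m p + transpose_mat E * E"
    using E by (simp add: transpose_add[of _ p p] transpose_mult_dim)
  moreover have "v \<bullet> ((1\<^sub>m p + transpose_mat E * E) *\<^sub>v v) > 0"
    if v: "v \<in> carrier_vec p" "v \<noteq> 0\<^sub>v p" for v
  proof -
    have "v \<bullet> ((1\<^sub>m p + transpose_mat E * E) *\<^sub>v v) = v \<bullet> v + (E *\<^sub>v v) \<bullet> (E *\<^sub>v v)"
      using E v scalar_prod_mult_mat_vec[of "transpose_mat E" v "E *\<^sub>v v"]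
      by (simp add: add_mult_distrib_mat_vec[of _ p p] assoc_mult_mat_vec_dim
          scalar_prod_add_distrib[of _ p])
    then show ?thesis
      using scalar_prod_self_pos[OF v] scalar_prod_self_ge_0[of "E *\<^sub>v v"] by simp
  qed
  ultimately show ?thesis using dims by (auto simp: sym_pos_def_def)
qed

lemma polar_factor:
  assumes E: "E \<in> carrier_mat q p" and T: "T \<in> carrier_mat p p"
    and orth: "transpose_mat T * (1\<^sub>m p + transpose_mat E * E) * T = 1\<^sub>m p"
  obtains N W where "N \<in> carrier_mat p p" "sym_pos_def N"
    "N * N * (1\<^sub>m p + transpose_mat E * E) = 1\<^sub>m p"
    "W \<in> carrier_mat p p" "orthonormal_cols W" "T = N * W"
proof -
  define M where "M = 1\<^sub>m p + transpose_mat E * E"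
  have M: "M \<in> carrier_mat p p" using E by (simp add: M_def)
  obtain N where N: "N \<in> carrier_mat p p" "sym_pos_def N" "N * N * M = 1\<^sub>m p"
    using sym_pos_def_inverse_sqrt[OF M] graph_gram_sym_pos_def[OF E] unfolding M_def by blast
  have Nsym: "transpose_mat N = N" using N by (simp add: sym_pos_def_def)
  have Msym: "transpose_mat M = M" using graph_gram_sym_pos_def[OF E] by (simp add: sym_pos_def_def M_def)
  note dims = M[THEN carrier_matD(1)] M[THEN carrier_matD(2)] T[THEN carrier_matD(1)] T[THEN carrier_matD(2)]
    N(1)[THEN carrier_matD(1)] N(1)[THEN carrier_matD(2)]
  have NNM: "N * (N * M) = 1\<^sub>m p" using N(3) by (simp add: assoc_mult_mat_dim dims)
  \<comment> \<open>\<open>N * M\<close> is the inverse of \<open>N\<close>, hence M^(1/2), and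
    \<open>orth\<close> is exactly the statement that M^(1/2) T is orthogonal.\<close>
  define W where "W = N * M * T"
  have "transpose_mat W * W = transpose_mat T * M * (N * (N * M)) * T"
    unfolding W_def by (simp add: transpose_mult_dim assoc_mult_mat_dim dims Nsym Msym)
  also have "\<dots> = 1\<^sub>m p" using orth M T by (simp add: NNM flip: M_def)
  finally have "transpose_mat W * W = 1\<^sub>m p" .
  moreover have "N * W = T"
  proof -
    have "N * W = (N * (N * M)) * T" unfolding W_def by (simp add: assoc_mult_mat_dim dims)
    then show ?thesis using T by (simp add: NNM)
  qed
  moreover have "W \<in> carrier_mat p p" using N M T by (simp add: W_def)
  ultimately show thesis
    using that[of N W] N by (simp add: M_def orthonormal_cols_def)
qed

text \<open>With w = T v one has |v|^2 = |w|^2 + |E w|^2, so the squared ratio |E T v|^2 / |v|^2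
  is the image of |E w|^2 / |w|^2 under the increasing map t / (1 + t).\<close>
lemma mnorm_graph:
  assumes E: "E \<in> carrier_mat q p" and T: "T \<in> carrier_mat p p"
    and orth: "transpose_mat T * (1\<^sub>m p + transpose_mat E * E) * T = 1\<^sub>m p"
    and inv: "invertible_mat T"
  shows "mnorm (E * T) = mnorm E / sqrt (1 + (mnorm E)\<^sup>2)"
proof -
  define e where "e = mnorm E"
  define f where "f = mnorm (E * T)"
  note dims = carrier_matD[OF E] carrier_matD[OF T]
  have e0: "0 \<le> e" and f0: "0 \<le> f" by (simp_all add: e_def f_def)
  have "0 < 1 + e\<^sup>2" by (simp add: add_pos_nonneg)
  have upper: "f \<le> e / sqrt (1 + e\<^sup>2)" unfolding f_def
  proof (rule mnorm_le)
    show "0 \<le> e / sqrt (1 + e\<^sup>2)" using e0 by simp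
    fix v :: "real vec" assume "v \<in> carrier_vec (dim_col (E * T))"
    then have v: "v \<in> carrier_vec p" using dims by simp
    define w where "w = T *\<^sub>v v"
    have w: "w \<in> carrier_vec p" using T v by (simp add: w_def)
    have "vnorm (E *\<^sub>v w) \<le> e * vnorm w"
      unfolding e_def using w dims by (intro vnorm_mult_mat_vec_le) simp
    then have "(E *\<^sub>v w) \<bullet> (E *\<^sub>v w) \<le> e\<^sup>2 * (w \<bullet> w)" using e0 by (simp add: vnorm_le_iff)
    moreover have "v \<bullet> v = w \<bullet> w + (E *\<^sub>v w) \<bullet> (E *\<^sub>v w)"
      unfolding w_def by (rule graph_norm_split[OF E T orth v])
    ultimately have "(E *\<^sub>v w) \<bullet> (E *\<^sub>v w) * (1 + e\<^sup>2) \<le> e\<^sup>2 * (v \<bullet> v)"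
      by (simp add: algebra_simps)
    then have "(E *\<^sub>v w) \<bullet> (E *\<^sub>v w) \<le> (e / sqrt (1 + e\<^sup>2))\<^sup>2 * (v \<bullet> v)"
      using \<open>0 < 1 + e\<^sup>2\<close> by (simp add: power_divide field_simps)
    then have "vnorm (E *\<^sub>v w) \<le> e / sqrt (1 + e\<^sup>2) * vnorm v"
      using e0 by (subst vnorm_le_iff) simp_all
    then show "vnorm (E * T *\<^sub>v v) \<le> e / sqrt (1 + e\<^sup>2) * vnorm v"
      using dims v by (simp add: w_def assoc_mult_mat_vec_dim)
  qed
  \<comment> \<open>The reverse estimate uses the inverse map t / (1 - t), which requires f < 1; the
    upper bound just proved supplies this.\<close>
  have "f\<^sup>2 \<le> e\<^sup>2 / (1 + e\<^sup>2)"
    using power_mono[OF upper f0, of 2] \<open>0 < 1 + e\<^sup>2\<close> by (simp add: power_divide)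
  also have "\<dots> < 1" using \<open>0 < 1 + e\<^sup>2\<close> by simp
  finally have f1: "f\<^sup>2 < 1" .
  \<comment> \<open>A right inverse of \<open>T\<close> writes every w as T v, so the bound on
    \<open>E * T\<close> can be read back as a bound on \<open>E\<close>.\<close>
  obtain T' where T': "T * T' = 1\<^sub>m p" "T' \<in> carrier_mat p p"
  proof -
    from inv obtain T' where "inverts_mat T T'" "inverts_mat T' T" by (auto simp: invertible_mat_def)
    then have TT: "T * T' = 1\<^sub>m p" "T' * T = 1\<^sub>m (dim_row T')" using dims by (auto simp: inverts_mat_def)
    have "dim_col T' = p" using arg_cong[OF TT(1), of dim_col] by simp
    moreover have "dim_row T' = p" using arg_cong[OF TT(2), of dim_col] dims by simp
    ultimately show thesis using that TT by auto
  qed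
  have e_le: "e \<le> sqrt (f\<^sup>2 / (1 - f\<^sup>2))" unfolding e_def
  proof (rule mnorm_le)
    show "0 \<le> sqrt (f\<^sup>2 / (1 - f\<^sup>2))" using f1 by simp
    fix w :: "real vec" assume "w \<in> carrier_vec (dim_col E)"
    then have w: "w \<in> carrier_vec p" using dims by simp
    define v where "v = T' *\<^sub>v w"
    have v: "v \<in> carrier_vec p" using T' w by (simp add: v_def)
    have Tv: "T *\<^sub>v v = w"
      using T' w dims by (simp add: v_def T'(1) flip: assoc_mult_mat_vec_dim)
    have "vnorm (E * T *\<^sub>v v) \<le> f * vnorm v"
      unfolding f_def using v dims by (intro vnorm_mult_mat_vec_le) simp
    then have "(E *\<^sub>v w) \<bullet> (E *\<^sub>v w) \<le> f\<^sup>2 * (v \<bullet> v)"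
      using f0 v dims by (simp add: vnorm_le_iff assoc_mult_mat_vec_dim Tv)
    then have "(E *\<^sub>v w) \<bullet> (E *\<^sub>v w) * (1 - f\<^sup>2) \<le> f\<^sup>2 * (w \<bullet> w)"
      using graph_norm_split[OF E T orth v] unfolding Tv by (simp add: algebra_simps)
    then have "(E *\<^sub>v w) \<bullet> (E *\<^sub>v w) \<le> (sqrt (f\<^sup>2 / (1 - f\<^sup>2)))\<^sup>2 * (w \<bullet> w)"
      using f1 by (simp add: field_simps)
    then show "vnorm (E *\<^sub>v w) \<le> sqrt (f\<^sup>2 / (1 - f\<^sup>2)) * vnorm w"
      using f1 by (subst vnorm_le_iff) simp_all
  qed
  have "e\<^sup>2 \<le> f\<^sup>2 / (1 - f\<^sup>2)"
    using power_mono[OF e_le e0, of 2] f1 by simp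
  then have "e\<^sup>2 \<le> f\<^sup>2 * (1 + e\<^sup>2)" using f1 by (simp add: field_simps)
  then have "(e / sqrt (1 + e\<^sup>2))\<^sup>2 \<le> f\<^sup>2"
    using \<open>0 < 1 + e\<^sup>2\<close> by (simp add: power_divide field_simps)
  then have "e / sqrt (1 + e\<^sup>2) \<le> f" using f0 by (rule power2_le_imp_le)
  with upper show ?thesis by (simp add: e_def f_def)
qed

section \<open>Perturbation of Ritz values\<close>

text \<open>The conditions on v are the rows of a square matrix whose row \<open>i0\<close> vanishes.\<close>
lemma exists_constrained_vec:
  fixes T :: "real mat" and \<pi> :: "nat \<Rightarrow> nat" and S :: "nat \<Rightarrow> bool"
  assumes T: "T \<in> carrier_mat p p" and \<pi>: "\<And>j. j < p \<Longrightarrow> \<pi> j < p" and i0: "i0 < p"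
  obtains v where "v \<in> carrier_vec p" "v \<noteq> 0\<^sub>v p"
    "\<And>j. j < p \<Longrightarrow> j \<noteq> i0 \<Longrightarrow> S j \<Longrightarrow> (T *\<^sub>v v) $ j = 0"
    "\<And>j. j < p \<Longrightarrow> j \<noteq> i0 \<Longrightarrow> \<not> S j \<Longrightarrow> v $ \<pi> j = 0"
proof -
  define K where "K = mat p p (\<lambda>(j, l). if j = i0 then 0 else if S j then T $$ (j, l)
    else if l = \<pi> j then 1 else 0 :: real)"
  have K: "K \<in> carrier_mat p p" by (simp add: K_def)
  \<comment> \<open>The vanishing row puts a unit vector into the kernel of the transpose; via the
    determinant, \<open>K\<close> itself has a nonzero kernel vector.\<close>
  have "transpose_mat K *\<^sub>v unit_vec p i0 = 0\<^sub>v p"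
    using i0 by (intro eq_vecI) (auto simp: K_def)
  moreover have "unit_vec p i0 \<noteq> (0\<^sub>v p :: real vec)" using i0 by simp
  ultimately have "det (transpose_mat K) = 0"
    using K by (subst det_0_iff_vec_prod_zero[of _ p]) (auto intro!: exI[of _ "unit_vec p i0"])
  then have "det K = 0" using det_transpose[OF K] by simp
  then obtain v where v: "v \<in> carrier_vec p" "v \<noteq> 0\<^sub>v p" "K *\<^sub>v v = 0\<^sub>v p"
    using det_0_iff_vec_prod_zero[OF K] by blast
  have row: "(\<Sum>l = 0..<p. K $$ (j, l) * v $ l) = 0" if "j < p" for j
  proof -
    have "(\<Sum>l = 0..<p. K $$ (j, l) * v $ l) = (K *\<^sub>v v) $ j"
      using that K v(1) by (simp add: scalar_prod_def)
    then show ?thesis using that by (simp add: v(3))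
  qed
  show thesis
  proof (rule that[OF v(1,2)])
    fix j assume j: "j < p" "j \<noteq> i0" "S j"
    then show "(T *\<^sub>v v) $ j = 0"
      using row[OF j(1)] T v(1) by (simp add: K_def scalar_prod_def)
  next
    fix j assume j: "j < p" "j \<noteq> i0" "\<not> S j"
    have "(\<Sum>l = 0..<p. K $$ (j, l) * v $ l) = (\<Sum>l = 0..<p. if l = \<pi> j then v $ l else 0)"
      using j by (intro sum.cong) (auto simp: K_def)
    then show "v $ \<pi> j = 0" using row[OF j(1)] \<pi>[OF j(1)] by simp
  qed
qed

text \<open>A Courant--Fischer comparison: with w = T v, the two Rayleigh quotients of v and w
  differ by at most |E w|^2 / |v|^2, which is bounded by the squared norm of E T.\<close>
lemma ritz_value_perturbation:
  fixes a ah b :: "nat \<Rightarrow> real"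
  assumes E: "E \<in> carrier_mat q p" and T: "T \<in> carrier_mat p p"
    and orth: "transpose_mat T * (1\<^sub>m p + transpose_mat E * E) * T = 1\<^sub>m p"
    and ritz: "transpose_mat T * (diagm p a + transpose_mat E * diagm q b * E) * T = diagm p ah"
    and a: "\<And>i. i < p \<Longrightarrow> 0 \<le> a i \<and> a i \<le> 1" and b: "\<And>i. i < q \<Longrightarrow> 0 \<le> b i \<and> b i \<le> 1"
    and \<pi>: "bij_betw \<pi> {..<p} {..<p}"
    and mono: "\<And>i j. i < p \<Longrightarrow> j < p \<Longrightarrow> a i < a j \<Longrightarrow> ah (\<pi> i) \<le> ah (\<pi> j)"
    and i0: "i0 < p"
  shows "\<bar>ah (\<pi> i0) - a i0\<bar> \<le> (mnorm (E * T))\<^sup>2"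
proof -
  define e where "e = mnorm (E * T)"
  have pi_lt: "\<pi> j < p" if "j < p" for j using \<pi> that by (auto simp: bij_betw_def)
  have pi_surj: "\<exists>j<p. l = \<pi> j" if "l < p" for l using \<pi> that by (auto simp: bij_betw_def)
  have energy: "(E *\<^sub>v (T *\<^sub>v v)) \<bullet> (E *\<^sub>v (T *\<^sub>v v)) \<le> e\<^sup>2 * (v \<bullet> v)" if v: "v \<in> carrier_vec p" for v :: "real vec"
  proof -
    have "vnorm (E * T *\<^sub>v v) \<le> e * vnorm v"
      unfolding e_def using v T by (intro vnorm_mult_mat_vec_le) auto
    moreover have "E * T *\<^sub>v v = E *\<^sub>v (T *\<^sub>v v)" using E T v by (intro assoc_mult_mat_vec) auto
    ultimately show ?thesis by (simp add: vnorm_le_iff e_def)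
  qed
  have split: "(\<Sum>l<p. (v $ l)\<^sup>2) = (\<Sum>i<p. ((T *\<^sub>v v) $ i)\<^sup>2)
      + (E *\<^sub>v (T *\<^sub>v v)) \<bullet> (E *\<^sub>v (T *\<^sub>v v))" if v: "v \<in> carrier_vec p" for v :: "real vec"
    using graph_norm_split[OF E T orth v] v T
    by (simp add: scalar_prod_self[of v] scalar_prod_self[of "T *\<^sub>v v"] del: index_mult_mat_vec)
  have quad: "(\<Sum>l<p. ah l * (v $ l)\<^sup>2) = (\<Sum>i<p. a i * ((T *\<^sub>v v) $ i)\<^sup>2)
      + (\<Sum>i<q. b i * ((E *\<^sub>v (T *\<^sub>v v)) $ i)\<^sup>2)" if v: "v \<in> carrier_vec p" for v :: "real vec"
    using quadratic_form_graph[OF diagm_carrier[of p a] E diagm_carrier[of q b] T v] E T v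
    unfolding ritz by (simp add: scalar_prod_diagm del: index_mult_mat_vec)
  have b_sum: "0 \<le> (\<Sum>i<q. b i * (u $ i)\<^sup>2)" "(\<Sum>i<q. b i * (u $ i)\<^sup>2) \<le> u \<bullet> u" if "dim_vec u = q" for u :: "real vec"
    using b that by (auto simp: scalar_prod_self intro!: sum_nonneg sum_mono mult_left_le_one_le)
  have pos: "0 < (\<Sum>l<p. (v $ l)\<^sup>2)" if "v \<in> carrier_vec p" "v \<noteq> 0\<^sub>v p" for v :: "real vec"
    using scalar_prod_self_pos[OF that] that by (simp add: scalar_prod_self)
  have upper: "ah (\<pi> i0) \<le> a i0 + e\<^sup>2"
  proof -
    \<comment> \<open>The p - 1 conditions confine w to indices with \<open>a j \<le> a i0\<close>
      and v to the labels of \<open>i0\<close> and of the indices with \<open>a i0 < a j\<close>.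
      Ties are removed on the side of v, because \<open>mono\<close> compares labels only under
      strict inequality.\<close>
    obtain v where v: "v \<in> carrier_vec p" "v \<noteq> 0\<^sub>v p"
      and w0: "\<And>j. j < p \<Longrightarrow> j \<noteq> i0 \<Longrightarrow> a i0 < a j \<Longrightarrow> (T *\<^sub>v v) $ j = 0"
      and v0: "\<And>j. j < p \<Longrightarrow> j \<noteq> i0 \<Longrightarrow> \<not> a i0 < a j \<Longrightarrow> v $ \<pi> j = 0"
      by (rule exists_constrained_vec[OF T, of \<pi> i0 "\<lambda>j. a i0 < a j"]) (auto simp: pi_lt i0)
    define z where "z = (E *\<^sub>v (T *\<^sub>v v)) \<bullet> (E *\<^sub>v (T *\<^sub>v v))"
    have z: "0 \<le> z" "z \<le> e\<^sup>2 * (\<Sum>l<p. (v $ l)\<^sup>2)"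
      using energy[OF v(1)] v(1) by (simp_all add: z_def scalar_prod_self_ge_0 scalar_prod_self[of v] del: index_mult_mat_vec)
    have "ah (\<pi> i0) * (\<Sum>l<p. (v $ l)\<^sup>2) \<le> (\<Sum>l<p. ah l * (v $ l)\<^sup>2)"
      unfolding sum_distrib_left
    proof (rule sum_mono)
      fix l assume "l \<in> {..<p}"
      then obtain j where j: "j < p" "l = \<pi> j" using pi_surj by blast
      show "ah (\<pi> i0) * (v $ l)\<^sup>2 \<le> ah l * (v $ l)\<^sup>2"
        using v0[of j] mono[OF i0 j(1)] j by (cases "j = i0"; cases "a i0 < a j") (auto intro: mult_right_mono)
    qed
    also have "\<dots> \<le> a i0 * (\<Sum>i<p. ((T *\<^sub>v v) $ i)\<^sup>2) + z"
      unfolding quad[OF v(1)] z_def sum_distrib_left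
    proof (rule add_mono)
      show "(\<Sum>i<p. a i * ((T *\<^sub>v v) $ i)\<^sup>2) \<le> (\<Sum>i<p. a i0 * ((T *\<^sub>v v) $ i)\<^sup>2)"
      proof (rule sum_mono)
        fix i assume "i \<in> {..<p}"
        then show "a i * ((T *\<^sub>v v) $ i)\<^sup>2 \<le> a i0 * ((T *\<^sub>v v) $ i)\<^sup>2"
          using w0[of i] by (cases "i = i0"; cases "a i0 < a i") (auto intro: mult_right_mono)
      qed
    qed (rule b_sum(2), use E in simp)
    also have "\<dots> \<le> a i0 * (\<Sum>l<p. (v $ l)\<^sup>2) + z"
      using split[OF v(1)] z a[OF i0] by (simp add: z_def mult_left_mono del: index_mult_mat_vec)
    also have "\<dots> \<le> (a i0 + e\<^sup>2) * (\<Sum>l<p. (v $ l)\<^sup>2)"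
      using z by (simp add: algebra_simps)
    finally show ?thesis using pos[OF v] by simp
  qed
  have lower: "a i0 \<le> ah (\<pi> i0) + e\<^sup>2"
  proof -
    obtain v where v: "v \<in> carrier_vec p" "v \<noteq> 0\<^sub>v p"
      and w0: "\<And>j. j < p \<Longrightarrow> j \<noteq> i0 \<Longrightarrow> a j < a i0 \<Longrightarrow> (T *\<^sub>v v) $ j = 0"
      and v0: "\<And>j. j < p \<Longrightarrow> j \<noteq> i0 \<Longrightarrow> \<not> a j < a i0 \<Longrightarrow> v $ \<pi> j = 0"
      by (rule exists_constrained_vec[OF T, of \<pi> i0 "\<lambda>j. a j < a i0"]) (auto simp: pi_lt i0)
    define z where "z = (E *\<^sub>v (T *\<^sub>v v)) \<bullet> (E *\<^sub>v (T *\<^sub>v v))"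
    have z: "0 \<le> z" "z \<le> e\<^sup>2 * (\<Sum>l<p. (v $ l)\<^sup>2)"
      using energy[OF v(1)] v(1) by (simp_all add: z_def scalar_prod_self_ge_0 scalar_prod_self[of v] del: index_mult_mat_vec)
    \<comment> \<open>Here the mass on E w is counted with weight \<open>a i0\<close>, so
      \<open>a i0 \<le> 1\<close> plays the part that \<open>b i \<le> 1\<close> has in the upper
      bound.\<close>
    have "a i0 * z \<le> z" using a[OF i0] z(1) by (simp add: mult_left_le_one_le)
    then have "a i0 * (\<Sum>l<p. (v $ l)\<^sup>2) \<le> a i0 * (\<Sum>i<p. ((T *\<^sub>v v) $ i)\<^sup>2) + z"
      unfolding split[OF v(1)] z_def[symmetric] by (simp add: distrib_left)
    also have "a i0 * (\<Sum>i<p. ((T *\<^sub>v v) $ i)\<^sup>2) \<le> (\<Sum>i<p. a i * ((T *\<^sub>v v) $ i)\<^sup>2)"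
      unfolding sum_distrib_left
    proof (rule sum_mono)
      fix i assume "i \<in> {..<p}"
      then show "a i0 * ((T *\<^sub>v v) $ i)\<^sup>2 \<le> a i * ((T *\<^sub>v v) $ i)\<^sup>2"
        using w0[of i] by (cases "i = i0"; cases "a i < a i0") (auto intro: mult_right_mono)
    qed
    also have "(\<Sum>i<p. a i * ((T *\<^sub>v v) $ i)\<^sup>2) \<le> (\<Sum>l<p. ah l * (v $ l)\<^sup>2)"
      using b_sum(1)[of "E *\<^sub>v (T *\<^sub>v v)"] E unfolding quad[OF v(1)] by (simp del: index_mult_mat_vec)
    also have "\<dots> \<le> ah (\<pi> i0) * (\<Sum>l<p. (v $ l)\<^sup>2)"
      unfolding sum_distrib_left
    proof (rule sum_mono)
      fix l assume "l \<in> {..<p}"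
      then obtain j where j: "j < p" "l = \<pi> j" using pi_surj by blast
      show "ah l * (v $ l)\<^sup>2 \<le> ah (\<pi> i0) * (v $ l)\<^sup>2"
        using v0[of j] mono[OF j(1) i0] j by (cases "j = i0"; cases "a j < a i0") (auto intro: mult_right_mono)
    qed
    finally have "a i0 * (\<Sum>l<p. (v $ l)\<^sup>2) \<le> (ah (\<pi> i0) + e\<^sup>2) * (\<Sum>l<p. (v $ l)\<^sup>2)"
      using z by (simp add: algebra_simps)
    then show ?thesis using pos[OF v] by simp
  qed
  show ?thesis using upper lower by (simp add: e_def abs_le_iff)
qed

text \<open>The weighted root equals sqrt (s^4 + c^4), and (x + y)^2 <= 2 (x^2 + y^2) applied to c^2
  + s^2 = 1 bounds it below by 1 / sqrt 2. The factor s^2 cancels the pole of the tangent.\<close>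

lemma chordal_weight_bound:
  fixes c s :: real
  assumes cs: "c\<^sup>2 + s\<^sup>2 = 1" and s: "s \<noteq> 0"
  shows "1 \<le> sqrt 2 * (s\<^sup>2 * sqrt (1 + ((c / s)\<^sup>2)\<^sup>2))"
proof -
  have "s\<^sup>2 * sqrt (1 + ((c / s)\<^sup>2)\<^sup>2) = sqrt ((s\<^sup>2)\<^sup>2 * (1 + ((c / s)\<^sup>2)\<^sup>2))"
    by (simp only: real_sqrt_mult real_sqrt_abs) simp
  also have "(s\<^sup>2)\<^sup>2 * (1 + ((c / s)\<^sup>2)\<^sup>2) = (s\<^sup>2)\<^sup>2 + (c\<^sup>2)\<^sup>2"
    using s by (simp add: power_divide field_simps)
  finally have *: "s\<^sup>2 * sqrt (1 + ((c / s)\<^sup>2)\<^sup>2) = sqrt ((s\<^sup>2)\<^sup>2 + (c\<^sup>2)\<^sup>2)" .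
  have "1 = (c\<^sup>2 + s\<^sup>2)\<^sup>2" by (simp add: cs)
  also have "\<dots> \<le> 2 * ((s\<^sup>2)\<^sup>2 + (c\<^sup>2)\<^sup>2)"
    using sum_squares_bound[of "c\<^sup>2" "s\<^sup>2"] by (simp add: power2_sum)
  finally show ?thesis unfolding * by (simp flip: real_sqrt_mult)
qed

text \<open>Clearing sines turns the numerator of the metric into the difference of squared cosines
  and its denominator into two weights of size at least 1 / sqrt 2. When exactly one sine vanishes,
  that difference is in modulus the square of the other sine and a single weight remains.\<close>

lemma chordal_e_sqratio_le:
  assumes cs: "c\<^sup>2 + s\<^sup>2 = 1" and csh: "ch\<^sup>2 + sh\<^sup>2 = 1"
  shows "chordal_e (sqratio ch sh) (sqratio c s) \<le> 2 * \<bar>ch\<^sup>2 - c\<^sup>2\<bar>"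
proof -
  have one: "1 / sqrt (1 + ((x / y)\<^sup>2)\<^sup>2) \<le> 2 * y\<^sup>2" if xy: "x\<^sup>2 + y\<^sup>2 = 1" "y \<noteq> 0" for x y :: real
  proof -
    let ?r = "sqrt (1 + ((x / y)\<^sup>2)\<^sup>2)"
    have r: "0 < ?r" by (simp add: add_pos_nonneg)
    have "1 \<le> sqrt 2 * (y\<^sup>2 * ?r)" by (rule chordal_weight_bound[OF xy])
    also have "\<dots> \<le> 2 * (y\<^sup>2 * ?r)"
      using r by (intro mult_right_mono) (auto simp: real_sqrt_le_iff intro: real_le_lsqrt)
    finally show ?thesis using r by (simp add: field_simps)
  qed
  show ?thesis
  proof (cases "s = 0"; cases "sh = 0")
    assume "s = 0" "sh = 0"
    then show ?thesis by (simp add: sqratio_def chordal_e_def)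
  next
    assume "s = 0" "sh \<noteq> 0"
    moreover have "\<bar>ch\<^sup>2 - c\<^sup>2\<bar> = sh\<^sup>2"
    proof -
      have "ch\<^sup>2 - c\<^sup>2 = - sh\<^sup>2" using cs csh \<open>s = 0\<close> by simp
      then show ?thesis by simp
    qed
    ultimately show ?thesis using one[OF csh] by (simp add: sqratio_def chordal_e_def)
  next
    assume "s \<noteq> 0" "sh = 0"
    moreover have "\<bar>ch\<^sup>2 - c\<^sup>2\<bar> = s\<^sup>2"
    proof -
      have "ch\<^sup>2 - c\<^sup>2 = s\<^sup>2" using cs csh \<open>sh = 0\<close> by simp
      then show ?thesis by simp
    qed
    ultimately show ?thesis using one[OF cs] by (simp add: sqratio_def chordal_e_def)
  next
    assume ne: "s \<noteq> 0" "sh \<noteq> 0"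
    let ?x = "(ch / sh)\<^sup>2" and ?y = "(c / s)\<^sup>2"
    let ?P = "sqrt (1 + ?x\<^sup>2)" and ?R = "sqrt (1 + ?y\<^sup>2)"
    have pos: "0 < ?P" "0 < ?R" by (simp_all add: add_pos_nonneg)
    have "?x - ?y = (ch\<^sup>2 * s\<^sup>2 - c\<^sup>2 * sh\<^sup>2) / (sh\<^sup>2 * s\<^sup>2)"
      using ne by (simp add: power_divide field_simps)
    also have "ch\<^sup>2 * s\<^sup>2 - c\<^sup>2 * sh\<^sup>2 = ch\<^sup>2 - c\<^sup>2"
    proof -
      have sq: "s\<^sup>2 = 1 - c\<^sup>2" "sh\<^sup>2 = 1 - ch\<^sup>2" using cs csh by linarith+
      show ?thesis unfolding sq by (simp add: algebra_simps)
    qed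
    finally have diff: "\<bar>?x - ?y\<bar> = \<bar>ch\<^sup>2 - c\<^sup>2\<bar> / (sh\<^sup>2 * s\<^sup>2)" by (simp add: abs_divide)
    have "1 * 1 \<le> (sqrt 2 * (sh\<^sup>2 * ?P)) * (sqrt 2 * (s\<^sup>2 * ?R))"
      using chordal_weight_bound[OF csh ne(2)] chordal_weight_bound[OF cs ne(1)]
      by (intro mult_mono) auto
    also have "\<dots> = 2 * (sh\<^sup>2 * s\<^sup>2) * (?P * ?R)" by (simp add: mult_ac)
    finally have "\<bar>ch\<^sup>2 - c\<^sup>2\<bar> * 1 \<le> \<bar>ch\<^sup>2 - c\<^sup>2\<bar> * (2 * (sh\<^sup>2 * s\<^sup>2) * (?P * ?R))"
      by (intro mult_left_mono) auto
    then have "\<bar>?x - ?y\<bar> \<le> 2 * \<bar>ch\<^sup>2 - c\<^sup>2\<bar> * (?P * ?R)"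
      unfolding diff using ne by (simp add: pos_divide_le_eq mult_ac)
    then have "chordal ?x ?y \<le> 2 * \<bar>ch\<^sup>2 - c\<^sup>2\<bar>"
      unfolding chordal_def using pos by (simp only: pos_divide_le_eq mult_pos_pos)
    then show ?thesis using ne by (simp add: sqratio_def chordal_e_def)
  qed
qed

section \<open>Matrix polynomials, coordinate blocks and Gram matrices\<close>

lemma minv_inverse:
  assumes M: "M \<in> carrier_mat n n" and inv: "invertible_mat M"
  shows "minv M \<in> carrier_mat n n" "M * minv M = 1\<^sub>m n" "minv M * M = 1\<^sub>m n"
proof -
  have "\<exists>B. inverts_mat M B \<and> inverts_mat B M" using inv by (auto simp: invertible_mat_def)
  then have "inverts_mat M (minv M) \<and> inverts_mat (minv M) M"
    unfolding minv_def by (rule someI_ex)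
  then have inv: "M * minv M = 1\<^sub>m n" "minv M * M = 1\<^sub>m (dim_row (minv M))"
    using M by (auto simp: inverts_mat_def)
  \<comment> \<open>\<open>inverts_mat\<close> fixes no shape, so the dimensions of
    \<open>minv M\<close> are read off the two identity matrices.\<close>
  have "dim_col (minv M) = n" using arg_cong[OF inv(1), of dim_col] by simp
  moreover have "dim_row (minv M) = n" using arg_cong[OF inv(2), of dim_col] M by simp
  ultimately show "minv M \<in> carrier_mat n n" "M * minv M = 1\<^sub>m n" "minv M * M = 1\<^sub>m n"
    using inv by auto
qed

lemma invertible_mat_right_inverse:
  fixes M B :: "real mat"
  assumes "M \<in> carrier_mat n n" "B \<in> carrier_mat n n" "M * B = 1\<^sub>m n"
  shows "invertible_mat M"
  using assms mat_mult_left_right_inverse[OF assms]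
  by (auto simp: invertible_mat_def inverts_mat_def intro!: exI[of _ B])

lemma invertible_mat_mult:
  fixes M N :: "real mat"
  assumes M: "M \<in> carrier_mat n n" "invertible_mat M" and N: "N \<in> carrier_mat n n" "invertible_mat N"
  shows "invertible_mat (M * N)"
proof (rule invertible_mat_right_inverse[of _ n "minv N * minv M"])
  note mi = minv_inverse[OF M] and ni = minv_inverse[OF N]
  show "M * N \<in> carrier_mat n n" "minv N * minv M \<in> carrier_mat n n" using M N mi ni by auto
  have "M * N * (minv N * minv M) = M * (N * minv N) * minv M"
    using M(1) N(1) mi(1) ni(1) by (simp add: assoc_mult_mat_dim)
  then show "M * N * (minv N * minv M) = 1\<^sub>m n" using M mi by (simp add: ni)
qed

lemma cheb_mat_carrier: "S \<in> carrier_mat n n \<Longrightarrow> cheb_mat j S \<in> carrier_mat n n"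
  by (induction j S rule: cheb_mat.induct) auto

text \<open>The intertwining form S X = X D needs no inverse of \<open>X\<close> and is preserved by
  the three-term recurrence, which acts on the diagonal entry by entry.\<close>

lemma cheb_mat_diagonalized:
  assumes S: "S \<in> carrier_mat n n" and X: "X \<in> carrier_mat n n" and SX: "S * X = X * diagm n f"
  shows "cheb_mat j S * X = X * diagm n (\<lambda>i. cheb j (f i))"
proof (induction j rule: induct_nat_012)
  case 0
  then show ?case using S X by (simp add: diagm_one)
next
  case 1
  then show ?case using SX by simp
next
  case (ge2 j)
  note Cj = cheb_mat_carrier[OF S, of j] and Cs = cheb_mat_carrier[OF S, of "Suc j"]
  have SC: "S * cheb_mat (Suc j) S \<in> carrier_mat n n" using S Cs by simp
  have "cheb_mat (Suc (Suc j)) S * X = 2 \<cdot>\<^sub>m (S * cheb_mat (Suc j) S * X) - cheb_mat j S * X"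
    using minus_mult_distrib_mat[of "2 \<cdot>\<^sub>m (S * cheb_mat (Suc j) S)" n n "cheb_mat j S" X n] SC Cj X
    by (simp add: mult_smult_assoc_mat[OF SC X])
  also have "S * cheb_mat (Suc j) S * X = X * diagm n f * diagm n (\<lambda>i. cheb (Suc j) (f i))"
  proof -
    have "S * cheb_mat (Suc j) S * X = S * (cheb_mat (Suc j) S * X)"
      by (rule assoc_mult_mat[OF S Cs X])
    also have "\<dots> = S * X * diagm n (\<lambda>i. cheb (Suc j) (f i))"
      unfolding ge2.IH(2) by (rule assoc_mult_mat[OF S X diagm_carrier, symmetric])
    finally show ?thesis by (simp only: SX)
  qed
  also have "\<dots> = X * diagm n (\<lambda>i. f i * cheb (Suc j) (f i))"
    using X by (simp add: assoc_mult_mat_dim diagm_mult_diagm)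
  also have "2 \<cdot>\<^sub>m (X * diagm n (\<lambda>i. f i * cheb (Suc j) (f i))) - cheb_mat j S * X
      = X * diagm n (\<lambda>i. cheb (Suc (Suc j)) (f i))"
    unfolding ge2.IH(1) using X
    by (intro eq_matI) (auto simp: mult_diagm_index algebra_simps simp del: index_mult_mat(1))
  finally show ?case .
qed

lemma psi_mat_diagonalized:
  assumes S: "S \<in> carrier_mat n n" and X: "X \<in> carrier_mat n n" and SX: "S * X = X * diagm n f"
  shows "psi_mat d cmin cmax S \<in> carrier_mat n n"
    and "psi_mat d cmin cmax S * X = X * diagm n (\<lambda>i. psi d cmin cmax (f i))"
proof -
  define w where "w j = rho j d * eta cmin cmax j" for j
  \<comment> \<open>The claim is made for an arbitrary list so that induction can peel off its head;
    the carrier part travels along because the algebraic laws need it.\<close>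
  have *: "foldr (\<lambda>j acc. acc + w j \<cdot>\<^sub>m cheb_mat j S) js (0\<^sub>m n n) \<in> carrier_mat n n \<and>
    foldr (\<lambda>j acc. acc + w j \<cdot>\<^sub>m cheb_mat j S) js (0\<^sub>m n n) * X
      = X * diagm n (\<lambda>i. \<Sum>j\<leftarrow>js. w j * cheb j (f i))" for js
  proof (induction js)
    case Nil
    then show ?case using X by (auto intro!: eq_matI simp: mult_diagm_index simp del: index_mult_mat(1))
  next
    case (Cons j js)
    let ?F = "foldr (\<lambda>j acc. acc + w j \<cdot>\<^sub>m cheb_mat j S) js (0\<^sub>m n n)"
    note C = cheb_mat_carrier[OF S, of j]
    have "(?F + w j \<cdot>\<^sub>m cheb_mat j S) * X = ?F * X + w j \<cdot>\<^sub>m (cheb_mat j S * X)"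
      using Cons C X by (simp add: add_mult_distrib_mat[of _ n n _ X n] mult_smult_assoc_mat[OF C X])
    also have "\<dots> = X * diagm n (\<lambda>i. \<Sum>j\<leftarrow>j # js. w j * cheb j (f i))"
      unfolding cheb_mat_diagonalized[OF S X SX] Cons[THEN conjunct2] using X
      by (intro eq_matI) (auto simp: mult_diagm_index algebra_simps simp del: index_mult_mat(1))
    finally show ?case using Cons C by simp
  qed
  have sum: "(\<Sum>j\<leftarrow>[0..<Suc d]. w j * cheb j x) = psi d cmin cmax x" for x
    unfolding psi_def w_def[symmetric] interv_sum_list_conv_sum_set_nat
    by (simp add: atLeast0LessThan flip: lessThan_Suc_atMost)
  have S': "dim_row S = n" using S by simp
  show "psi_mat d cmin cmax S \<in> carrier_mat n n"
    using *[of "[0..<Suc d]"] unfolding psi_mat_def w_def S' by blast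
  show "psi_mat d cmin cmax S * X = X * diagm n (\<lambda>i. psi d cmin cmax (f i))"
    using *[of "[0..<Suc d]", THEN conjunct2] unfolding sum unfolding psi_mat_def w_def S' .
qed

text \<open>Together with \<open>sel_rest\<close> these are the columns of the identity matrix.
  Multiplying by them turns column blocks into products, so block arguments become associativity and
  a few fixed products.\<close>

definition sel_first :: "nat \<Rightarrow> nat \<Rightarrow> real mat" where
  "sel_first n p = mat n p (\<lambda>(i, j). if i = j then 1 else 0)"

definition sel_rest :: "nat \<Rightarrow> nat \<Rightarrow> real mat" where
  "sel_rest n p = mat n (n - p) (\<lambda>(i, j). if i = j + p then 1 else 0)"

lemma sel_dim [simp]:
  "dim_row (sel_first n p) = n" "dim_col (sel_first n p) = p"
  "dim_row (sel_rest n p) = n" "dim_col (sel_rest n p) = n - p"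
  by (simp_all add: sel_first_def sel_rest_def)

lemma cols_first_conv: "X \<in> carrier_mat m n \<Longrightarrow> p \<le> n \<Longrightarrow> cols_first p X = X * sel_first n p"
  by (rule eq_matI)
    (auto simp: cols_first_def sel_first_def scalar_prod_def if_distrib[of "(*) _"] sum.delta cong: if_cong)

lemma cols_rest_conv: "X \<in> carrier_mat m n \<Longrightarrow> p \<le> n \<Longrightarrow> cols_rest p X = X * sel_rest n p"
  by (rule eq_matI)
    (auto simp: cols_rest_def sel_rest_def scalar_prod_def if_distrib[of "(*) _"] sum.delta cong: if_cong)

lemma sel_products:
  assumes "p \<le> n"
  shows "transpose_mat (sel_first n p) * sel_first n p = 1\<^sub>m p"
    and "transpose_mat (sel_first n p) * sel_rest n p = 0\<^sub>m p (n - p)"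
    and "transpose_mat (sel_rest n p) * sel_first n p = 0\<^sub>m (n - p) p"
    and "transpose_mat (sel_rest n p) * sel_rest n p = 1\<^sub>m (n - p)"
  using assms
  by (auto intro!: eq_matI sum.neutral simp: sel_first_def sel_rest_def scalar_prod_def if_distrib[of "(*) _"]
      sum.delta cong: if_cong)

lemma sel_complete:
  assumes "p \<le> n"
  shows "sel_first n p * transpose_mat (sel_first n p) + sel_rest n p * transpose_mat (sel_rest n p) = 1\<^sub>m n"
proof (rule eq_matI)
  fix i j assume "i < dim_row (1\<^sub>m n :: real mat)" "j < dim_col (1\<^sub>m n :: real mat)"
  then have ij: "i < n" "j < n" by auto
  have "(\<Sum>k = 0..<p. (if i = k then 1 else 0) * (if j = k then 1 else 0 :: real)) = (if i = j \<and> i < p then 1 else 0)"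
    by (auto simp: if_distrib[of "(*) _"] sum.delta cong: if_cong)
  moreover have "(\<Sum>k = 0..<n - p. (if i = k + p then 1 else 0) * (if j = k + p then 1 else 0 :: real))
      = (\<Sum>k = 0..<n - p. if k = i - p then (if i = j \<and> p \<le> i then 1 else 0) else 0)"
    by (rule sum.cong) auto
  ultimately show "(sel_first n p * transpose_mat (sel_first n p) + sel_rest n p * transpose_mat (sel_rest n p)) $$ (i, j)
    = 1\<^sub>m n $$ (i, j)"
    using ij assms by (auto simp: sel_first_def sel_rest_def scalar_prod_def sum.delta)
qed simp_all

lemma diagm_sel:
  assumes "p \<le> n"
  shows "diagm n f * sel_first n p = sel_first n p * diagm p f"
    and "diagm n f * sel_rest n p = sel_rest n p * diagm (n - p) (\<lambda>i. f (i + p))"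
  using assms
  by (auto intro!: eq_matI simp: mult_diagm_index diagm_mult_index simp del: index_mult_mat(1))
    (auto simp: sel_first_def sel_rest_def)

text \<open>\<open>U\<close> is square, so its orthonormal columns also give U U^T = I, and
  \<open>U\<close> drops out of the Gram matrix of \<open>SA\<close>.\<close>

lemma gsvd_gram:
  fixes A X U SA :: "real mat"
  assumes A: "A \<in> carrier_mat m n" and X: "X \<in> carrier_mat n n"
    and U: "U \<in> carrier_mat m m" "orthonormal_cols U"
    and SA: "transpose_mat U * A * X = SA" "transpose_mat SA * SA = diagm n f"
  shows "transpose_mat X * (transpose_mat A * A) * X = diagm n f"
proof -
  have UU: "U * transpose_mat U = 1\<^sub>m m"
    using mat_mult_left_right_inverse[of "transpose_mat U" m U] U by (simp add: orthonormal_cols_def)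
  note dims = carrier_matD[OF A] carrier_matD[OF X] carrier_matD[OF U(1)]
  have "diagm n f = transpose_mat X * (transpose_mat A * ((U * transpose_mat U) * (A * X)))"
    unfolding SA(2)[symmetric] SA(1)[symmetric]
    by (simp add: transpose_mult_dim assoc_mult_mat_dim dims)
  then show ?thesis unfolding UU by (simp add: assoc_mult_mat_dim dims one_mult_mat_dim)
qed

text \<open>The thin factorization and the small decomposition combine to A Q Xbar = Q1 Ubar diag f;
  both orthonormal factors cancel in the Gram matrix, leaving the squared Ritz cosines.\<close>

lemma ritz_gram:
  fixes A Q Q1 Abar Ubar Xbar :: "real mat"
  assumes A: "A \<in> carrier_mat m n" and Q: "Q \<in> carrier_mat n p"
    and Q1: "Q1 \<in> carrier_mat m p" "orthonormal_cols Q1" and Abar: "Abar \<in> carrier_mat p p"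
    and AQ: "A * Q = Q1 * Abar" and U: "Ubar \<in> carrier_mat p p" "orthonormal_cols Ubar"
    and X: "Xbar \<in> carrier_mat p p" "invertible_mat Xbar"
    and Abar_eq: "Abar = Ubar * diagm p f * minv Xbar"
  shows "transpose_mat (Q * Xbar) * (transpose_mat A * A) * (Q * Xbar) = diagm p (\<lambda>i. (f i)\<^sup>2)"
proof -
  note mi = minv_inverse[OF X]
  note dims = carrier_matD[OF A] carrier_matD[OF Q] carrier_matD[OF Q1(1)] carrier_matD[OF Abar]
    carrier_matD[OF U(1)] carrier_matD[OF X(1)] carrier_matD[OF mi(1)]
  have orth: "transpose_mat Q1 * Q1 = 1\<^sub>m p" "transpose_mat Ubar * Ubar = 1\<^sub>m p"
    using Q1 U by (simp_all add: orthonormal_cols_def)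
  have "A * (Q * Xbar) = A * Q * Xbar" by (simp add: assoc_mult_mat_dim dims)
  also have "\<dots> = Q1 * (Ubar * (diagm p f * (minv Xbar * Xbar)))"
    unfolding AQ Abar_eq by (simp add: assoc_mult_mat_dim dims)
  finally have AX: "A * (Q * Xbar) = Q1 * (Ubar * diagm p f)"
    by (simp add: mi(3) mult_one_mat_dim)
  have "transpose_mat (Q * Xbar) * (transpose_mat A * A) * (Q * Xbar)
      = transpose_mat (A * (Q * Xbar)) * (A * (Q * Xbar))"
    by (simp add: transpose_mult_dim assoc_mult_mat_dim dims)
  also have "\<dots> = diagm p f * (transpose_mat Ubar * ((transpose_mat Q1 * Q1) * (Ubar * diagm p f)))"
    unfolding AX by (simp add: transpose_mult_dim assoc_mult_mat_dim dims)
  also have "\<dots> = diagm p f * ((transpose_mat Ubar * Ubar) * diagm p f)"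
    unfolding orth(1) by (simp add: one_mult_mat_dim assoc_mult_mat_dim dims)
  also have "\<dots> = diagm p (\<lambda>i. (f i)\<^sup>2)"
    unfolding orth(2) by (simp add: one_mult_mat_dim diagm_mult_diagm power2_eq_square)
  finally show ?thesis .
qed

section \<open>Subspace iteration\<close>

text \<open>The identity stacked on \<open>E\<close>: its columns form a basis of the graph of
  \<open>E\<close>, in coordinates along \<open>X\<close>.\<close>

definition graph_mat :: "nat \<Rightarrow> nat \<Rightarrow> real mat \<Rightarrow> real mat" where
  "graph_mat n p E = sel_first n p + sel_rest n p * E"

lemma graph_mat_dim [simp]: "dim_row (graph_mat n p E) = n" "dim_col (graph_mat n p E) = dim_col E"
  by (simp_all add: graph_mat_def)

lemma cols_graph:
  assumes "X \<in> carrier_mat m n" "p \<le> n" "E \<in> carrier_mat (n - p) p"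
  shows "cols_first p X + cols_rest p X * E = X * graph_mat n p E"
  using assms
  by (simp add: cols_first_conv cols_rest_conv graph_mat_def mult_add_distrib_mat_dim assoc_mult_mat_dim)

lemma sel_graph:
  assumes p: "p \<le> n" and E: "E \<in> carrier_mat (n - p) p"
  shows "transpose_mat (sel_first n p) * graph_mat n p E = 1\<^sub>m p"
    and "transpose_mat (sel_rest n p) * graph_mat n p E = E"
proof -
  have Ed: "dim_row E = n - p" "dim_col E = p" using E by auto
  have "transpose_mat (sel_first n p) * graph_mat n p E
      = transpose_mat (sel_first n p) * sel_first n p + (transpose_mat (sel_first n p) * sel_rest n p) * E"
    by (simp add: graph_mat_def mult_add_distrib_mat_dim assoc_mult_mat_dim Ed)
  then show "transpose_mat (sel_first n p) * graph_mat n p E = 1\<^sub>m p"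
    unfolding sel_products[OF p] using E by simp
  have "transpose_mat (sel_rest n p) * graph_mat n p E
      = transpose_mat (sel_rest n p) * sel_first n p + (transpose_mat (sel_rest n p) * sel_rest n p) * E"
    by (simp add: graph_mat_def mult_add_distrib_mat_dim assoc_mult_mat_dim Ed)
  then show "transpose_mat (sel_rest n p) * graph_mat n p E = E"
    unfolding sel_products[OF p] using E by simp
qed

lemma diagm_graph:
  assumes p: "p \<le> n" and E: "E \<in> carrier_mat (n - p) p"
  shows "diagm n f * graph_mat n p E
    = sel_first n p * diagm p f + sel_rest n p * (diagm (n - p) (\<lambda>i. f (i + p)) * E)"
proof -
  have Ed: "dim_row E = n - p" "dim_col E = p" using E by auto
  have "diagm n f * graph_mat n p E = diagm n f * sel_first n p + diagm n f * sel_rest n p * E"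
    by (simp add: graph_mat_def mult_add_distrib_mat_dim assoc_mult_mat_dim Ed)
  then show ?thesis unfolding diagm_sel[OF p] by (simp add: assoc_mult_mat_dim Ed)
qed

text \<open>Congruence by \<open>X\<close> makes the form diagonal, so the leading and trailing
  blocks contribute without cross terms. Used with \<open>H\<close> it gives orthonormality of the
  Ritz basis, with the Gram matrix of \<open>A\<close> the Ritz condition.\<close>

lemma graph_gram:
  assumes X: "X \<in> carrier_mat n n" and M: "M \<in> carrier_mat n n" and p: "p \<le> n"
    and E: "E \<in> carrier_mat (n - p) p" and XMX: "transpose_mat X * M * X = diagm n f"
    and T: "T \<in> carrier_mat p p"
  shows "transpose_mat (X * graph_mat n p E * T) * M * (X * graph_mat n p E * T)
    = transpose_mat T * (diagm p f + transpose_mat E * diagm (n - p) (\<lambda>i. f (i + p)) * E) * T"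
proof -
  let ?Z = "graph_mat n p E" and ?G = "diagm (n - p) (\<lambda>i. f (i + p))"
  note dims = carrier_matD[OF X] carrier_matD[OF M] carrier_matD[OF E] carrier_matD[OF T]
  have Zsel: "transpose_mat ?Z * sel_first n p = 1\<^sub>m p" "transpose_mat ?Z * sel_rest n p = transpose_mat E"
    using arg_cong[OF sel_graph(1)[OF p E], of transpose_mat]
      arg_cong[OF sel_graph(2)[OF p E], of transpose_mat]
    by (simp_all add: transpose_mult_dim dims)
  have "transpose_mat (X * ?Z * T) * M * (X * ?Z * T)
      = transpose_mat T * (transpose_mat ?Z * ((transpose_mat X * M * X) * ?Z)) * T"
    by (simp add: transpose_mult_dim assoc_mult_mat_dim dims)
  also have "transpose_mat ?Z * ((transpose_mat X * M * X) * ?Z)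
      = (transpose_mat ?Z * sel_first n p) * diagm p f + (transpose_mat ?Z * sel_rest n p) * (?G * E)"
    unfolding XMX diagm_graph[OF p E]
    by (simp add: mult_add_distrib_mat_dim assoc_mult_mat_dim dims)
  also have "\<dots> = diagm p f + transpose_mat E * ?G * E"
    unfolding Zsel by (simp add: assoc_mult_mat_dim dims one_mult_mat_dim)
  finally show ?thesis .
qed

text \<open>If the columns of Q span the same space as X Z C, comparing the leading coordinates
  (those along the first p columns of X) identifies the change of basis.\<close>
lemma graph_basis_change:
  fixes X K Q R C :: "real mat"
  assumes X: "X \<in> carrier_mat n n" and K: "K \<in> carrier_mat n n" and KX: "K * X = 1\<^sub>m n"
    and p: "p \<le> n" and E: "E \<in> carrier_mat (n - p) p"
    and C: "C \<in> carrier_mat p p" "invertible_mat C"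
    and Q: "Q \<in> carrier_mat n p" and R: "R \<in> carrier_mat p p"
    and eq: "X * graph_mat n p E * C = Q * R"
  obtains L where "L \<in> carrier_mat p p" "invertible_mat L" "Q = X * graph_mat n p E * L"
proof -
  let ?Z = "graph_mat n p E"
  note ci = minv_inverse[OF C]
  note dims = carrier_matD[OF X] carrier_matD[OF K] carrier_matD[OF E] carrier_matD[OF C(1)]
    carrier_matD[OF Q] carrier_matD[OF R] carrier_matD[OF ci(1)]
  \<comment> \<open>\<open>K\<close> is the inverse of \<open>X\<close>, so \<open>L\<close> holds
    the leading coordinates of \<open>Q\<close>; on the graph these determine the whole
    vector.\<close>
  define L where "L = transpose_mat (sel_first n p) * (K * Q)"
  have L: "L \<in> carrier_mat p p" by (rule carrier_matI) (simp_all add: L_def dims)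
  have "L * R = transpose_mat (sel_first n p) * (K * (X * ?Z * C))"
    unfolding L_def eq by (simp add: assoc_mult_mat_dim dims)
  also have "\<dots> = transpose_mat (sel_first n p) * ((K * X) * (?Z * C))"
    by (simp add: assoc_mult_mat_dim dims)
  also have "\<dots> = (transpose_mat (sel_first n p) * ?Z) * C"
    unfolding KX by (simp add: one_mult_mat_dim assoc_mult_mat_dim dims)
  finally have LR: "L * R = C" unfolding sel_graph(1)[OF p E] by (simp add: one_mult_mat_dim dims)
  have "L * (R * minv C) = (L * R) * minv C" using L by (simp add: assoc_mult_mat_dim dims)
  then have "L * (R * minv C) = 1\<^sub>m p" by (simp add: LR ci)
  then have Linv: "invertible_mat L"
    using L R ci by (intro invertible_mat_right_inverse[of L p "R * minv C"]) auto
  \<comment> \<open>\<open>R\<close> is square, so this left inverse is also a right inverse, which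
    allows the equation to be solved for \<open>Q\<close>.\<close>
  have "minv C * L * R = 1\<^sub>m p" using L by (simp add: assoc_mult_mat_dim dims LR ci)
  then have R': "R * (minv C * L) = 1\<^sub>m p"
    using mat_mult_left_right_inverse[of "minv C * L" p R] L R ci by simp
  have "Q = Q * (R * (minv C * L))" unfolding R' by (simp add: mult_one_mat_dim dims)
  also have "\<dots> = (X * ?Z * C) * (minv C * L)"
    unfolding eq using L by (simp add: assoc_mult_mat_dim dims)
  also have "\<dots> = X * ?Z * ((C * minv C) * L)" using L by (simp add: assoc_mult_mat_dim dims)
  finally have "Q = X * ?Z * L" unfolding ci using L by (simp add: one_mult_mat_dim)
  then show thesis using that[OF L Linv] by simp
qed

text \<open>The invariant is that the iterate equals \<open>X * graph_mat n p (E k)\<close> times an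
  invertible matrix. Nonzero leading entries of \<open>g\<close> keep that factor invertible, and
  orthonormalization and the small decomposition merely multiply it by further invertible
  matrices.\<close>

lemma subspace_iteration_graph:
  fixes X K P :: "real mat" and E Xk Q R Xbar :: "nat \<Rightarrow> real mat"
  assumes X: "X \<in> carrier_mat n n" and K: "K \<in> carrier_mat n n" and KX: "K * X = 1\<^sub>m n"
    and P: "P \<in> carrier_mat n n" "P * X = X * diagm n g" and p: "p \<le> n"
    and g: "\<And>i. i < p \<Longrightarrow> g i \<noteq> 0"
    and X0: "Xk 0 = X * graph_mat n p (E 0) * C" "C \<in> carrier_mat p p" "invertible_mat C"
    and E: "\<And>k. E k \<in> carrier_mat (n - p) p"
    and Estep: "\<And>k. E (Suc k) * diagm p g = diagm (n - p) (\<lambda>i. g (i + p)) * E k"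
    and Q: "\<And>k. Q k \<in> carrier_mat n p" and R: "\<And>k. R k \<in> carrier_mat p p"
    and QR: "\<And>k. Xk k = Q k * R k"
    and Xbar: "\<And>k. Xbar k \<in> carrier_mat p p" "\<And>k. invertible_mat (Xbar k)"
    and iter: "\<And>k. Xk (Suc k) = P * (Q k * Xbar k)"
  shows "\<exists>T. T \<in> carrier_mat p p \<and> invertible_mat T \<and> Q k * Xbar k = X * graph_mat n p (E k) * T"
proof -
  have step: "\<exists>T. T \<in> carrier_mat p p \<and> invertible_mat T \<and> Q k * Xbar k = X * graph_mat n p (E k) * T"
    if C: "C \<in> carrier_mat p p" "invertible_mat C" "Xk k = X * graph_mat n p (E k) * C" for k C
  proof -
    obtain L where L: "L \<in> carrier_mat p p" "invertible_mat L" "Q k = X * graph_mat n p (E k) * L"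
      using graph_basis_change[OF X K KX p E C(1,2) Q R] C(3) QR by metis
    have "Q k * Xbar k = X * graph_mat n p (E k) * (L * Xbar k)"
      using L(1) Xbar(1)[of k] X E[of k] unfolding L(3) by (simp add: assoc_mult_mat_dim)
    then show ?thesis using L Xbar invertible_mat_mult[OF L(1,2) Xbar(1,2)] by (meson mult_carrier_mat)
  qed
  have Gamma: "invertible_mat (diagm p g)"
    by (rule invertible_mat_right_inverse[of _ p "diagm p (\<lambda>i. 1 / g i)"])
      (use g in \<open>simp_all add: diagm_mult_diagm diagm_one\<close>)
  have "\<exists>C. C \<in> carrier_mat p p \<and> invertible_mat C \<and> Xk k = X * graph_mat n p (E k) * C"
  proof (induction k)
    case 0
    then show ?case using X0 by blast
  next
    case (Suc k)
    then obtain T where T: "T \<in> carrier_mat p p" "invertible_mat T"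
      "Q k * Xbar k = X * graph_mat n p (E k) * T" using step by blast
    note dims = carrier_matD[OF X] carrier_matD[OF P(1)] carrier_matD[OF T(1)]
      E[of k, THEN carrier_matD(1)] E[of k, THEN carrier_matD(2)]
      E[of "Suc k", THEN carrier_matD(1)] E[of "Suc k", THEN carrier_matD(2)]
    have "Xk (Suc k) = (P * X) * (graph_mat n p (E k) * T)"
      unfolding iter T(3) by (simp add: assoc_mult_mat_dim dims)
    also have "\<dots> = X * ((diagm n g * graph_mat n p (E k)) * T)"
      unfolding P(2) by (simp add: assoc_mult_mat_dim dims)
    \<comment> \<open>\<open>Estep\<close> replaces the trailing diagonal block to the left of
      \<open>E k\<close> by the leading one to the right of \<open>E (Suc k)\<close>, so the latter
      factors out.\<close>
    also have "diagm n g * graph_mat n p (E k) = graph_mat n p (E (Suc k)) * diagm p g"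
      unfolding diagm_graph[OF p E] Estep[symmetric]
      by (simp add: graph_mat_def add_mult_distrib_mat_dim assoc_mult_mat_dim dims)
    finally have "Xk (Suc k) = X * graph_mat n p (E (Suc k)) * (diagm p g * T)"
      by (simp add: assoc_mult_mat_dim dims)
    moreover have "diagm p g * T \<in> carrier_mat p p" using T by (intro mult_carrier_mat) auto
    ultimately show ?case using invertible_mat_mult[OF diagm_carrier Gamma T(1,2)] by blast
  qed
  then show ?thesis using step by blast
qed

text \<open>Indices start at 0, so \<open>\<gamma> (p - 1)\<close> and \<open>\<gamma> p\<close> are
  the p-th and (p+1)-st filter values. \<open>N\<close> is M^(-1/2), characterized as the positive
  definite matrix whose square inverts M. The filter decreases only within each index group, so
  \<open>gamma_p_min\<close> states separately that the p-th value is the smallest leading one. The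
  labelling is a permutation \<open>\<pi>\<close> of all \<open>p\<close> Ritz values that respects
  strict order of the cosines.\<close>

theorem theorem4p1:
  fixes A B U V X SA SB :: "real mat"
    and m1 m2 n p r ngv d :: nat
    and c s :: "nat \<Rightarrow> real"
    and cmin cmax :: real
    and Xk Q R Q1 Abar Q2 Bbar Ubar Vbar Xbar :: "nat \<Rightarrow> real mat"
    and ch sh :: "nat \<Rightarrow> nat \<Rightarrow> real"
  assumes A: "A \<in> carrier_mat m1 n" and B: "B \<in> carrier_mat m2 n"
    and mn: "m1 + m2 \<ge> n"
    and fullrank: "\<forall>v \<in> carrier_vec n. A *\<^sub>v v = 0\<^sub>v m1 \<and> B *\<^sub>v v = 0\<^sub>v m2 \<longrightarrow> v = 0\<^sub>v n"
  defines "H \<equiv> transpose_mat A * A + transpose_mat B * B"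
  assumes U: "U \<in> carrier_mat m1 m1" "orthonormal_cols U"
    and V: "V \<in> carrier_mat m2 m2" "orthonormal_cols V"
    and X: "X \<in> carrier_mat n n" "invertible_mat X" "transpose_mat X * H * X = 1\<^sub>m n"
    and SA: "transpose_mat U * A * X = SA" "transpose_mat SA * SA = diagm n (\<lambda>i. (c i)\<^sup>2)"
    and SB: "transpose_mat V * B * X = SB" "transpose_mat SB * SB = diagm n (\<lambda>i. (s i)\<^sup>2)"
    and cs: "\<forall>i<n. c i \<ge> 0 \<and> s i \<ge> 0 \<and> (c i)\<^sup>2 + (s i)\<^sup>2 = 1"
    and interval: "0 \<le> cmin" "cmin \<le> cmax" "cmax \<le> 1"
  defines "S \<equiv> minv H * (transpose_mat A * A - transpose_mat B * B)"
  defines "P \<equiv> psi_mat d cmin cmax S"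
  defines "\<gamma> \<equiv> (\<lambda>i. psi d cmin cmax (lmap (c i)))"
  assumes idx: "r \<le> ngv" "ngv \<le> n"
    and grp1: "\<forall>i<r. cmin < c i \<and> c i < cmax"
    and grp2: "\<forall>i. r \<le> i \<and> i < ngv \<longrightarrow> c i = cmin \<or> c i = cmax"
    and grp3: "\<forall>i. ngv \<le> i \<and> i < n \<longrightarrow> c i < cmin \<or> cmax < c i"
    and dec1: "\<forall>i j. i \<le> j \<and> j < r \<longrightarrow> \<gamma> j \<le> \<gamma> i"
    and dec2: "\<forall>i j. r \<le> i \<and> i \<le> j \<and> j < ngv \<longrightarrow> \<gamma> j \<le> \<gamma> i"
    and dec3: "\<forall>i j. ngv \<le> i \<and> i \<le> j \<and> j < n \<longrightarrow> \<gamma> j \<le> \<gamma> i"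
    and p: "ngv \<le> p" "0 < p" "p < n"
    and gap: "\<gamma> p < \<gamma> (p - 1)"
    and gamma_p_min: "\<forall>i<p. \<gamma> (p - 1) \<le> \<gamma> i"
  defines "Xp \<equiv> cols_first p X" and "Xperp \<equiv> cols_rest p X"
  assumes X0: "Xk 0 \<in> carrier_mat n p" "full_col_rank (Xk 0)"
    and X0nonsing: "invertible_mat (transpose_mat Xp * H * Xk 0)"
    and QR: "\<forall>k. Q k \<in> carrier_mat n p \<and> orthonormal_cols (Q k) \<and>
                 R k \<in> carrier_mat p p \<and> upper_triangular (R k) \<and> Xk k = Q k * R k"
    and QRA: "\<forall>k. full_col_rank (A * Q k) \<and>
                 Q1 k \<in> carrier_mat m1 p \<and> orthonormal_cols (Q1 k) \<and>
                 Abar k \<in> carrier_mat p p \<and> upper_triangular (Abar k) \<and> A * Q k = Q1 k * Abar k"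
    and QRB: "\<forall>k. full_col_rank (B * Q k) \<and>
                 Q2 k \<in> carrier_mat m2 p \<and> orthonormal_cols (Q2 k) \<and>
                 Bbar k \<in> carrier_mat p p \<and> upper_triangular (Bbar k) \<and> B * Q k = Q2 k * Bbar k"
    and GSVDk: "\<forall>k. Ubar k \<in> carrier_mat p p \<and> orthonormal_cols (Ubar k) \<and>
                 Vbar k \<in> carrier_mat p p \<and> orthonormal_cols (Vbar k) \<and>
                 Xbar k \<in> carrier_mat p p \<and> invertible_mat (Xbar k) \<and>
                 Abar k = Ubar k * diagm p (ch k) * minv (Xbar k) \<and>
                 Bbar k = Vbar k * diagm p (sh k) * minv (Xbar k) \<and>
                 (\<forall>i<p. ch k i \<ge> 0 \<and> sh k i \<ge> 0 \<and> (ch k i)\<^sup>2 + (sh k i)\<^sup>2 = 1)"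
  defines "Xhat \<equiv> (\<lambda>k. Q k * Xbar k)"
  assumes iter: "\<forall>k. Xk (Suc k) = P * Xhat k"
  defines "E \<equiv> (\<lambda>k::nat. diagm (n - p) (\<lambda>i. \<gamma> (i + p) ^ k) * transpose_mat Xperp * H * Xk 0
                 * minv (transpose_mat Xp * H * Xk 0) * diagm p (\<lambda>i. 1 / \<gamma> i ^ k))"
  defines "eps \<equiv> (\<lambda>k. mnorm (transpose_mat Xperp * H * Xhat k))"
  shows "\<forall>k.
     (\<exists>N W. N \<in> carrier_mat p p \<and> sym_pos_def N \<and>
            N * N * (1\<^sub>m p + transpose_mat (E k) * E k) = 1\<^sub>m p \<and>
            W \<in> carrier_mat p p \<and> orthonormal_cols W \<and>
            Xhat k = (Xp + Xperp * E k) * N * W)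
   \<and> mnorm (E k) \<le> (\<gamma> p / \<gamma> (p - 1)) ^ k * mnorm (E 0)
   \<and> eps k = mnorm (E k) / sqrt (1 + (mnorm (E k))\<^sup>2)
   \<and> eps k \<le> (\<gamma> p / \<gamma> (p - 1)) ^ k * mnorm (E 0)
   \<and> (\<forall>\<pi>. bij_betw \<pi> {..<p} {..<p} \<and>
          (\<forall>i<p. \<forall>j<p. c i < c j \<longrightarrow> ch k (\<pi> i) \<le> ch k (\<pi> j)) \<longrightarrow>
          (\<forall>i<ngv. chordal_e (sqratio (ch k (\<pi> i)) (sh k (\<pi> i))) (sqratio (c i) (s i))
                     \<le> 6 * (eps k)\<^sup>2 + 2 * (eps k)^4))"
proof -

  \<comment> \<open>Coordinates along \<open>X\<close>, the action of the filter, and the signs of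
    its values\<close>
  have pn: "p \<le> n" using p by simp
  have H: "H \<in> carrier_mat n n" using A B by (simp add: H_def)
  have AA: "transpose_mat A * A \<in> carrier_mat n n" and BB: "transpose_mat B * B \<in> carrier_mat n n"
    using A B by auto
  note dims = carrier_matD[OF X(1)] carrier_matD[OF H] carrier_matD[OF X0(1)]
  define K where "K = transpose_mat X * H"
  have K: "K \<in> carrier_mat n n" using X(1) H by (simp add: K_def)
  have KX: "K * X = 1\<^sub>m n" using X(3) by (simp add: K_def)
  have XK: "X * K = 1\<^sub>m n" by (rule mat_mult_left_right_inverse[OF K X(1) KX])
  have XXH: "(X * transpose_mat X) * H = 1\<^sub>m n"
    using XK by (simp add: K_def assoc_mult_mat_dim dims)
  have XXc: "X * transpose_mat X \<in> carrier_mat n n" using X(1) by simp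
  have "H * (X * transpose_mat X) = 1\<^sub>m n" by (rule mat_mult_left_right_inverse[OF XXc H XXH])
  then have "invertible_mat H" by (rule invertible_mat_right_inverse[OF H XXc])
  note Hinv = minv_inverse[OF H this]
  have GA: "transpose_mat X * (transpose_mat A * A) * X = diagm n (\<lambda>i. (c i)\<^sup>2)"
    by (rule gsvd_gram[OF A X(1) U SA])
  have GB: "transpose_mat X * (transpose_mat B * B) * X = diagm n (\<lambda>i. (s i)\<^sup>2)"
    by (rule gsvd_gram[OF B X(1) V SB])
  have S: "S \<in> carrier_mat n n" using Hinv(1) AA BB by (simp add: S_def minus_carrier_mat)
  have SX: "S * X = X * diagm n (\<lambda>i. lmap (c i))"
  proof -
    define D where "D = transpose_mat A * A - transpose_mat B * B"
    have D: "D \<in> carrier_mat n n" using AA BB by (simp add: D_def minus_carrier_mat)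
    \<comment> \<open>Inserting X K = I brings the factor \<open>H\<close> of \<open>K\<close> next
      to \<open>minv H\<close>, where the two cancel.\<close>
    have "S * X = (X * K) * (S * X)" unfolding XK using S X(1) by simp
    also have "\<dots> = X * (transpose_mat X * ((H * minv H) * (D * X)))"
      unfolding K_def S_def D_def[symmetric] using D Hinv(1) by (simp add: assoc_mult_mat_dim dims)
    also have "\<dots> = X * (transpose_mat X * D * X)"
      unfolding Hinv(2) using D X(1) by (simp add: assoc_mult_mat_dim one_mult_mat_dim dims)
    also have "transpose_mat X * D * X
        = transpose_mat X * (transpose_mat A * A) * X - transpose_mat X * (transpose_mat B * B) * X"
      unfolding D_def using X(1) AA BB
      by (simp add: mult_minus_distrib_mat[of _ n n] minus_mult_distrib_mat[of _ n n _ X n])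
    also have "\<dots> = diagm n (\<lambda>i. lmap (c i))"
      unfolding GA GB
    proof (rule eq_matI)
      fix i j assume "i < dim_row (diagm n (\<lambda>i. lmap (c i)))" "j < dim_col (diagm n (\<lambda>i. lmap (c i)))"
      then show "(diagm n (\<lambda>i. (c i)\<^sup>2) - diagm n (\<lambda>i. (s i)\<^sup>2)) $$ (i, j) = diagm n (\<lambda>i. lmap (c i)) $$ (i, j)"
        using cs[rule_format, of i] by (auto simp: lmap_def)
    qed simp_all
    finally show ?thesis .
  qed
  have P: "P \<in> carrier_mat n n" and PX: "P * X = X * diagm n \<gamma>"
    unfolding P_def \<gamma>_def by (rule psi_mat_diagonalized[OF S X(1) SX])+
  have c_sq: "0 \<le> (c i)\<^sup>2 \<and> (c i)\<^sup>2 \<le> 1" if "i < n" for i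
    using cs that by (metis le_add_same_cancel1 zero_le_power2)
  have gamma_nonneg: "0 \<le> \<gamma> i" if "i < n" for i
    unfolding \<gamma>_def using c_sq[OF that] by (intro psi_nonneg interval) (simp add: lmap_def abs_le_iff)
  have gamma_pos: "0 < \<gamma> i" "\<gamma> (p - 1) \<le> \<gamma> i" if "i < p" for i
    using gamma_nonneg[of p] gap gamma_p_min that p by force+
  \<comment> \<open>Since \<open>ngv \<le> p\<close>, every index from \<open>p\<close> on lies in
    the third group, where the filter values decrease.\<close>
  have gamma_rest: "\<gamma> (i + p) \<le> \<gamma> p" "0 \<le> \<gamma> (i + p)" if "i < n - p" for i
    using dec3 gamma_nonneg p that by auto

  \<comment> \<open>Coordinate blocks of the starting matrix and the recurrence for
    \<open>E\<close>\<close>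
  define C0 where "C0 = transpose_mat Xp * H * Xk 0"
  define E0 where "E0 = transpose_mat Xperp * H * Xk 0 * minv C0"
  have Xp_conv: "Xp = X * sel_first n p" and Xperp_conv: "Xperp = X * sel_rest n p"
    unfolding Xp_def Xperp_def using X(1) pn by (simp_all add: cols_first_conv cols_rest_conv)
  have C0: "C0 \<in> carrier_mat p p" "invertible_mat C0"
    using X0nonsing by (auto simp: C0_def Xp_conv dims intro!: carrier_matI)
  note C0inv = minv_inverse[OF C0]
  have E0: "E0 \<in> carrier_mat (n - p) p"
    using C0inv(1) by (auto simp: E0_def Xperp_conv dims intro!: carrier_matI)
  have E_eq: "E k = diagm (n - p) (\<lambda>i. \<gamma> (i + p) ^ k) * E0 * diagm p (\<lambda>i. 1 / \<gamma> i ^ k)" for k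
    unfolding E_def E0_def C0_def[symmetric]
    using C0inv(1) by (simp add: Xperp_conv assoc_mult_mat_dim transpose_mult_dim dims)
  have E: "E k \<in> carrier_mat (n - p) p" for k
    unfolding E_eq using E0 by (intro mult_carrier_mat[of _ _ "p"] mult_carrier_mat[of _ _ "n - p"]) auto
  have E_0: "E 0 = E0"
    unfolding E_eq using E0 by (simp add: diagm_one)
  have E_step: "E (Suc k) * diagm p \<gamma> = diagm (n - p) (\<lambda>i. \<gamma> (i + p)) * E k" for k
  proof -
    have inv: "diagm p (\<lambda>i. 1 / \<gamma> i ^ Suc k) * diagm p \<gamma> = diagm p (\<lambda>i. 1 / \<gamma> i ^ k)"
      unfolding diagm_mult_diagm using gamma_pos(1)
      by (intro eq_matI) (force simp: diagm_def)+
    have "E (Suc k) * diagm p \<gamma>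
        = diagm (n - p) (\<lambda>i. \<gamma> (i + p) ^ Suc k) * (E0 * (diagm p (\<lambda>i. 1 / \<gamma> i ^ Suc k) * diagm p \<gamma>))"
      unfolding E_eq using E0 by (simp add: assoc_mult_mat_dim)
    also have "diagm (n - p) (\<lambda>i. \<gamma> (i + p) ^ Suc k)
        = diagm (n - p) (\<lambda>i. \<gamma> (i + p)) * diagm (n - p) (\<lambda>i. \<gamma> (i + p) ^ k)"
      unfolding diagm_mult_diagm by simp
    finally show ?thesis unfolding inv E_eq using E0 by (simp add: assoc_mult_mat_dim)
  qed
  have X0_graph: "Xk 0 = X * graph_mat n p (E 0) * C0"
  proof -
    let ?J = "sel_first n p" and ?J' = "sel_rest n p"
    have "E0 * C0 = transpose_mat Xperp * H * Xk 0 * (minv C0 * C0)"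
      unfolding E0_def using C0(1) C0inv(1) by (simp add: assoc_mult_mat_dim dims Xperp_conv)
    then have EC: "E0 * C0 = transpose_mat ?J' * (K * Xk 0)"
      unfolding C0inv(3) by (simp add: mult_one_mat_dim K_def Xperp_conv assoc_mult_mat_dim transpose_mult_dim dims)
    have C: "C0 = transpose_mat ?J * (K * Xk 0)"
      by (simp add: C0_def K_def Xp_conv assoc_mult_mat_dim transpose_mult_dim dims)
    \<comment> \<open>\<open>C0\<close> and \<open>E0 * C0\<close> are the leading and trailing
      coordinates of the starting block; reassembling them recovers it.\<close>
    have "X * graph_mat n p (E 0) * C0 = X * (?J * C0 + ?J' * (E0 * C0))"
      unfolding E_0 graph_mat_def using E0 C0(1)
      by (simp add: assoc_mult_mat_dim add_mult_distrib_mat_dim dims)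
    also have "\<dots> = X * ((?J * transpose_mat ?J + ?J' * transpose_mat ?J') * (K * Xk 0))"
      unfolding EC unfolding C using K by (simp add: assoc_mult_mat_dim add_mult_distrib_mat_dim dims)
    also have "\<dots> = (X * K) * Xk 0"
      unfolding sel_complete[OF pn] using K X0(1) by (simp add: assoc_mult_mat_dim one_mult_mat_dim dims)
    finally show ?thesis unfolding XK using X0(1) by simp
  qed

  \<comment> \<open>Factorization, norm estimates and Ritz values at a fixed iteration\<close>
  show ?thesis
  proof (rule allI)
    fix k
    define D where "D = (\<lambda>i. (c (i + p))\<^sup>2)"
    have "\<exists>T. T \<in> carrier_mat p p \<and> invertible_mat T \<and> Q k * Xbar k = X * graph_mat n p (E k) * T"
    proof (rule subspace_iteration_graph[where P = P and g = \<gamma> and Xk = Xk and E = E and R = R])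
      show "\<gamma> i \<noteq> 0" if "i < p" for i using gamma_pos(1)[OF that] by simp
    qed (use X(1) K KX P PX pn X0_graph C0 E E_step QR GSVDk iter in \<open>simp_all add: Xhat_def\<close>)
    then obtain T where T: "T \<in> carrier_mat p p" "invertible_mat T"
      and XT: "Xhat k = X * graph_mat n p (E k) * T"
      unfolding Xhat_def by blast
    note QRAk = QRA[rule_format, of k] and QRBk = QRB[rule_format, of k] and QRk = QR[rule_format, of k]
      and Gk = GSVDk[rule_format, of k]
    have gramA: "transpose_mat (Xhat k) * (transpose_mat A * A) * Xhat k = diagm p (\<lambda>i. (ch k i)\<^sup>2)"
      unfolding Xhat_def using QRAk QRk Gk by (intro ritz_gram[OF A, of _ p "Q1 k" "Abar k" "Ubar k"]) auto
    have gramB: "transpose_mat (Xhat k) * (transpose_mat B * B) * Xhat k = diagm p (\<lambda>i. (sh k i)\<^sup>2)"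
      unfolding Xhat_def using QRBk QRk Gk by (intro ritz_gram[OF B, of _ p "Q2 k" "Bbar k" "Vbar k"]) auto
    have Xh: "Xhat k \<in> carrier_mat n p" unfolding Xhat_def using QRk Gk by auto
    have gramH: "transpose_mat (Xhat k) * H * Xhat k = 1\<^sub>m p"
    proof -
      have "transpose_mat (Xhat k) * H * Xhat k
        = transpose_mat (Xhat k) * (transpose_mat A * A) * Xhat k
          + transpose_mat (Xhat k) * (transpose_mat B * B) * Xhat k"
        unfolding H_def using carrier_matD[OF Xh] carrier_matD[OF A] carrier_matD[OF B]
        by (simp add: mult_add_distrib_mat_dim add_mult_distrib_mat_dim)
      also have "\<dots> = 1\<^sub>m p" unfolding gramA gramB
      proof (rule eq_matI)
        fix i j assume "i < dim_row (1\<^sub>m p :: real mat)" "j < dim_col (1\<^sub>m p :: real mat)"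
        then show "(diagm p (\<lambda>i. (ch k i)\<^sup>2) + diagm p (\<lambda>i. (sh k i)\<^sup>2)) $$ (i, j) = 1\<^sub>m p $$ (i, j)"
          using Gk by auto
      qed simp_all
      finally show ?thesis .
    qed
    \<comment> \<open>The identity is written as a diagonal matrix to fit the shape that
      \<open>graph_gram\<close> expects.\<close>
    have "transpose_mat X * H * X = diagm n (\<lambda>_. 1)" using X(3) by (simp add: diagm_one)
    from graph_gram[OF X(1) H pn E this T(1), of k]
    have orth: "transpose_mat T * (1\<^sub>m p + transpose_mat (E k) * E k) * T = 1\<^sub>m p"
      using gramH E[of k] unfolding XT by (simp add: diagm_one mult_one_mat_dim)
    have ritz: "transpose_mat T * (diagm p (\<lambda>i. (c i)\<^sup>2) + transpose_mat (E k) * diagm (n - p) D * E k) * T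
        = diagm p (\<lambda>i. (ch k i)\<^sup>2)"
      using graph_gram[OF X(1) AA pn E GA T(1), of k] gramA unfolding XT D_def by simp
    have eps: "eps k = mnorm (E k * T)"
    proof -
      \<comment> \<open>The transpose of \<open>Xperp\<close> times \<open>H\<close> extracts
        trailing coordinates, which on the graph are E k times the leading ones.\<close>
      have "transpose_mat Xperp * H * Xhat k
          = transpose_mat (sel_rest n p) * ((K * X) * (graph_mat n p (E k) * T))"
        unfolding XT K_def Xperp_conv using T(1) E[of k]
        by (simp add: assoc_mult_mat_dim transpose_mult_dim dims)
      also have "\<dots> = (transpose_mat (sel_rest n p) * graph_mat n p (E k)) * T"
        unfolding KX using T(1) E[of k] by (simp add: assoc_mult_mat_dim one_mult_mat_dim)
      finally show ?thesis unfolding eps_def sel_graph(2)[OF pn E] by simp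
    qed
    have eps_eq: "eps k = mnorm (E k) / sqrt (1 + (mnorm (E k))\<^sup>2)"
      unfolding eps by (rule mnorm_graph[OF E T(1) orth T(2)])
    have factor: "\<exists>N W. N \<in> carrier_mat p p \<and> sym_pos_def N \<and>
        N * N * (1\<^sub>m p + transpose_mat (E k) * E k) = 1\<^sub>m p \<and>
        W \<in> carrier_mat p p \<and> orthonormal_cols W \<and> Xhat k = (Xp + Xperp * E k) * N * W"
    proof -
      obtain N W where NW: "N \<in> carrier_mat p p" "sym_pos_def N"
        "N * N * (1\<^sub>m p + transpose_mat (E k) * E k) = 1\<^sub>m p"
        "W \<in> carrier_mat p p" "orthonormal_cols W" "T = N * W"
        using polar_factor[OF E T(1) orth] by blast
      have "Xhat k = (Xp + Xperp * E k) * N * W"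
        unfolding XT NW(6) Xp_def Xperp_def cols_graph[OF X(1) pn E]
        using NW(1,4) E[of k] by (simp add: assoc_mult_mat_dim dims)
      then show ?thesis using NW by blast
    qed
    have norm_bound: "mnorm (E k) \<le> (\<gamma> p / \<gamma> (p - 1)) ^ k * mnorm (E 0)"
    proof -
      have pm: "0 < \<gamma> (p - 1)" using gamma_pos(1)[of "p - 1"] p by simp
      have "mnorm (E k) \<le> mnorm (diagm (n - p) (\<lambda>i. \<gamma> (i + p) ^ k) * E0) * mnorm (diagm p (\<lambda>i. 1 / \<gamma> i ^ k))"
        unfolding E_eq using E0 by (intro mnorm_mult_le) simp
      also have "\<dots> \<le> (\<gamma> p ^ k * mnorm E0) * (1 / \<gamma> (p - 1) ^ k)"
      proof (rule mult_mono)
        have "mnorm (diagm (n - p) (\<lambda>i. \<gamma> (i + p) ^ k) * E0) \<le> mnorm (diagm (n - p) (\<lambda>i. \<gamma> (i + p) ^ k)) * mnorm E0"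
          using E0 by (intro mnorm_mult_le) simp
        also have "\<dots> \<le> \<gamma> p ^ k * mnorm E0"
          using gamma_rest gamma_nonneg[of p] p
          by (intro mult_right_mono mnorm_diagm_le) (auto intro: power_mono)
        finally show "mnorm (diagm (n - p) (\<lambda>i. \<gamma> (i + p) ^ k) * E0) \<le> \<gamma> p ^ k * mnorm E0" .
        show "mnorm (diagm p (\<lambda>i. 1 / \<gamma> i ^ k)) \<le> 1 / \<gamma> (p - 1) ^ k"
        proof (rule mnorm_diagm_le)
          fix i assume i: "i < p"
          show "\<bar>1 / \<gamma> i ^ k\<bar> \<le> 1 / \<gamma> (p - 1) ^ k"
            using gamma_pos[OF i] pm by (simp add: frac_le power_mono)
        qed (use pm in simp)
      qed (use gamma_nonneg[of p] p in simp_all)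
      finally show ?thesis by (simp add: E_0 power_divide)
    qed
    have "eps k \<le> mnorm (E k)"
    proof -
      have "mnorm (E k) \<le> mnorm (E k) * sqrt (1 + (mnorm (E k))\<^sup>2)"
        using mult_left_mono[of 1 "sqrt (1 + (mnorm (E k))\<^sup>2)" "mnorm (E k)"] by simp
      then show ?thesis unfolding eps_eq by (simp add: pos_divide_le_eq add_pos_nonneg)
    qed
    with norm_bound have eps_bound: "eps k \<le> (\<gamma> p / \<gamma> (p - 1)) ^ k * mnorm (E 0)" by linarith
    have chordal: "chordal_e (sqratio (ch k (\<pi> i)) (sh k (\<pi> i))) (sqratio (c i) (s i))
        \<le> 6 * (eps k)\<^sup>2 + 2 * (eps k) ^ 4"
      if \<pi>: "bij_betw \<pi> {..<p} {..<p}"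
        and order: "\<forall>i<p. \<forall>j<p. c i < c j \<longrightarrow> ch k (\<pi> i) \<le> ch k (\<pi> j)" and i: "i < ngv" for \<pi> i
    proof -
      have ip: "i < p" using i p by simp
      have pi_lt: "\<pi> j < p" if "j < p" for j using \<pi> that by (auto simp: bij_betw_def)
      have "\<bar>(ch k (\<pi> i))\<^sup>2 - (c i)\<^sup>2\<bar> \<le> (eps k)\<^sup>2"
        unfolding eps
      proof (rule ritz_value_perturbation[OF E T(1) orth ritz _ _ \<pi> _ ip])
        show "0 \<le> (c j)\<^sup>2 \<and> (c j)\<^sup>2 \<le> 1" if "j < p" for j using c_sq[of j] that p by simp
        show "0 \<le> D j \<and> D j \<le> 1" if "j < n - p" for j using c_sq[of "j + p"] that by (simp add: D_def)
        show "(ch k (\<pi> j))\<^sup>2 \<le> (ch k (\<pi> l))\<^sup>2" if jl: "j < p" "l < p" "(c j)\<^sup>2 < (c l)\<^sup>2" for j l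
        proof -
          \<comment> \<open>The perturbation bound compares squares; nonnegativity of the cosines
            makes their order the same as that of the squares.\<close>
          have "c j < c l" using jl cs p by (intro power2_less_imp_less[of "c j"]) auto
          then show ?thesis using order jl Gk pi_lt by (simp add: power_mono)
        qed
      qed
      \<comment> \<open>The estimate 2 eps^2 lies below the stated bound, whose remaining terms 4
        eps^2 + 2 eps^4 are nonnegative.\<close>
      then have "2 * \<bar>(ch k (\<pi> i))\<^sup>2 - (c i)\<^sup>2\<bar> \<le> 6 * (eps k)\<^sup>2 + 2 * (eps k) ^ 4"
        by (rule order_trans[OF mult_left_mono, of _ _ 2]) simp_all
      moreover have "chordal_e (sqratio (ch k (\<pi> i)) (sh k (\<pi> i))) (sqratio (c i) (s i))
          \<le> 2 * \<bar>(ch k (\<pi> i))\<^sup>2 - (c i)\<^sup>2\<bar>"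
        using cs Gk pi_lt[OF ip] ip p by (intro chordal_e_sqratio_le) auto
      ultimately show ?thesis by (rule order_trans[rotated])
    qed
    show "(\<exists>N W. N \<in> carrier_mat p p \<and> sym_pos_def N \<and>
            N * N * (1\<^sub>m p + transpose_mat (E k) * E k) = 1\<^sub>m p \<and>
            W \<in> carrier_mat p p \<and> orthonormal_cols W \<and>
            Xhat k = (Xp + Xperp * E k) * N * W)
      \<and> mnorm (E k) \<le> (\<gamma> p / \<gamma> (p - 1)) ^ k * mnorm (E 0)
      \<and> eps k = mnorm (E k) / sqrt (1 + (mnorm (E k))\<^sup>2)
      \<and> eps k \<le> (\<gamma> p / \<gamma> (p - 1)) ^ k * mnorm (E 0)
      \<and> (\<forall>\<pi>. bij_betw \<pi> {..<p} {..<p} \<and>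
          (\<forall>i<p. \<forall>j<p. c i < c j \<longrightarrow> ch k (\<pi> i) \<le> ch k (\<pi> j)) \<longrightarrow>
          (\<forall>i<ngv. chordal_e (sqratio (ch k (\<pi> i)) (sh k (\<pi> i))) (sqratio (c i) (s i))
                     \<le> 6 * (eps k)\<^sup>2 + 2 * (eps k)^4))"
      using factor norm_bound eps_eq eps_bound chordal by blast
  qed
qed

end
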